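(* Let $U$ be a finite group and $A$ an abelian normal subgroup of $U$ containing the derived subgroup $U'$. Suppose there exists a group endomorphism $\gamma\in\mathrm{End}(U)$ such that $$A=U^{\gamma-1}U',$$ where $U^{\gamma-1}U'$ is the subgroup generated by $U'$ and the elements $\gamma(u)u^{-1}$, $u\in U$. Then the transfer $\mathrm{Ver}_{U/A}:U/U'\to A$ is trivial on the subgroup $(U/U')^{\langle\gamma\rangle}$ of elements of $U/U'$ fixed by the endomorphism of $U/U'$ induced by $\gamma$.
   Context: $\mathrm{Ver}_{U/A}$ denotes the group-theoretic transfer from $U$ to its subgroup $A$; since $A$ is abelian it is a homomorphism $U/U'\to A$. Note $U'$ is stable under $\gamma$, so $\gamma$ induces an endomorphism of $U/U'$. *)

theory Defs
  imports "HOL-Algebra.Algebra"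
begin

definition right_transversal :: "('a, 'b) monoid_scheme \<Rightarrow> 'a set \<Rightarrow> 'a set \<Rightarrow> bool" where
  "right_transversal G H T \<longleftrightarrow> T \<subseteq> carrier G \<and>
     (\<forall>g \<in> carrier G. \<exists>!t. t \<in> T \<and> H #>\<^bsub>G\<^esub> t = H #>\<^bsub>G\<^esub> g)"

definition transversal_rep :: "('a, 'b) monoid_scheme \<Rightarrow> 'a set \<Rightarrow> 'a set \<Rightarrow> 'a \<Rightarrow> 'a" where
  "transversal_rep G H T x = (THE t. t \<in> T \<and> H #>\<^bsub>G\<^esub> t = H #>\<^bsub>G\<^esub> x)"

text \<open>Group-theoretic transfer Ver from G to an abelian subgroup H of finite index:
  Ver(g) = prod over t in T of  t g (rep(t g))^-1, computed with a chosen right transversal T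
  (the value is independent of T). Since H is abelian, no quotient by H' is needed.\<close>
definition transfer :: "('a, 'b) monoid_scheme \<Rightarrow> 'a set \<Rightarrow> 'a \<Rightarrow> 'a" where
  "transfer G H g =
     (let T = (SOME T. right_transversal G H T)
      in finprod (G\<lparr>carrier := H\<rparr>)
           (\<lambda>t. t \<otimes>\<^bsub>G\<^esub> g \<otimes>\<^bsub>G\<^esub> inv\<^bsub>G\<^esub> (transversal_rep G H T (t \<otimes>\<^bsub>G\<^esub> g))) T)"

end

(* Let Q = U/A and let I_U, I_A be the augmentation ideals of Z[U], Z[A]. Since gamma acts
   trivially on Q, the module B = I_U / I_A I_U is a module over Z[Q][t], with t acting as
   gamma - 1, and it is generated by the classes d(g) = [g] - [1]. The transfer of u is the norm
   N d(u), N being the sum of the elements of Q, so it is enough to prove N d(u) = 0 in B.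

   The hypothesis A = U^(gamma-1) U' turns a triangular relation matrix of the abelian group Q
   into a square matrix W over Z[Q][t] with W d = 0, congruent to the relation matrix modulo t and
   the augmentation ideal. At t = 0 the determinant of W annihilates the augmentation ideal of Q
   and has augmentation |Q|, so det W = N + t s. The hypothesis on u gives one more relation
   r . d = 0 with r = t e_u - i, where i has entries in the augmentation ideal of Q. Replacing
   row k of W by r gives a matrix whose determinant tau_k is divisible by t: its value at t = 0
   annihilates the augmentation ideal and has augmentation 0. By Cramer's rule
   sum_k tau_k W_kj = (det W) r_j, and both sides can be divided by t as polynomials, after
   dropping constant terms; applying the quotient to the vector d gives N d(u) = 0. *)
theory Submission
  imports Defs "Jordan_Normal_Form.Determinant"
begin

section \<open>Adjugate identities over a commutative ring\<close>

text \<open>Expanding each modified determinant along its replaced row gives an entry of the row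
  vector \<open>r\<close> times the adjugate of \<open>W\<close>. Multiplying by \<open>W\<close>
  then produces \<open>det W\<close> times \<open>r\<close>.\<close>

lemma cramer_row_combination:
  fixes W :: "'r :: comm_ring_1 mat"
  assumes W: "W \<in> carrier_mat n n" and j: "j < n"
  shows "(\<Sum>k<n. det (mat n n (\<lambda>(i, l). if i = k then r l else W $$ (i, l))) * W $$ (k, j))
    = det W * r j"
proof -
  have tau: "det (mat n n (\<lambda>(i, l). if i = k then r l else W $$ (i, l)))
      = (\<Sum>l<n. r l * adj_mat W $$ (l, k))" if k: "k < n" for k
  proof -
    let ?P = "mat n n (\<lambda>(i, l). if i = k then r l else W $$ (i, l))"
    have "cofactor ?P k l = adj_mat W $$ (l, k)" if "l < n" for l
    proof -
      \<comment> \<open>The two matrices differ only in row \<open>k\<close>, which the minor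
        omits.\<close>
      have "mat_delete ?P k l = mat_delete W k l"
        using W k that unfolding mat_delete_def by (auto intro!: eq_matI)
      then show ?thesis using W k that by (simp add: cofactor_def adj_mat_def)
    qed
    moreover have "det ?P = (\<Sum>l<n. ?P $$ (k, l) * cofactor ?P k l)"
      by (rule laplace_expansion_row[OF _ k]) simp
    ultimately show ?thesis using k by (auto intro!: sum.cong)
  qed
  have adj: "(\<Sum>k<n. adj_mat W $$ (l, k) * W $$ (k, j)) = (if l = j then det W else 0)"
    if "l < n" for l
  proof -
    have "(\<Sum>k<n. adj_mat W $$ (l, k) * W $$ (k, j)) = (adj_mat W * W) $$ (l, j)"
      using W j that adj_mat(1)[OF W]
      by (auto simp: times_mat_def scalar_prod_def intro!: sum.cong)
    then show ?thesis using adj_mat(3)[OF W] j that by simp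
  qed
  have "(\<Sum>k<n. det (mat n n (\<lambda>(i, l). if i = k then r l else W $$ (i, l))) * W $$ (k, j))
      = (\<Sum>k<n. \<Sum>l<n. r l * (adj_mat W $$ (l, k) * W $$ (k, j)))"
    by (rule sum.cong) (auto simp: tau sum_distrib_right sum_distrib_left mult_ac)
  also have "\<dots> = (\<Sum>l<n. r l * (\<Sum>k<n. adj_mat W $$ (l, k) * W $$ (k, j)))"
    by (subst sum.swap) (simp add: sum_distrib_left)
  also have "\<dots> = (\<Sum>l<n. r l * (if l = j then det W else 0))"
    by (rule sum.cong) (simp_all add: adj)
  also have "\<dots> = det W * r j" using j by (simp add: sum.delta if_distrib cong: if_cong)
  finally show ?thesis .
qed

text \<open>Multiply the column of relations by the adjugate. The map \<open>Z\<close> stands for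
  reduction modulo an ideal, namely its zero set; it will be \<open>\<zeta>\<close> of the constant
  coefficient.\<close>

lemma det_annihilates_modulo:
  fixes W :: "'r :: comm_ring_1 mat" and Z :: "'r \<Rightarrow> 's :: ab_group_add"
  assumes W: "W \<in> carrier_mat n n" and j: "j < n"
    and add: "\<And>x y. Z (x + y) = Z x + Z y"
    and ideal: "\<And>x y. Z x = 0 \<Longrightarrow> Z (y * x) = 0"
    and rows: "\<And>i. i < n \<Longrightarrow> Z (\<Sum>l<n. W $$ (i, l) * \<beta> l) = 0"
  shows "Z (det W * \<beta> j) = 0"
proof -
  have Z0: "Z 0 = 0" using add[of 0 0] by simp
  have Zsum: "Z (\<Sum>i\<in>I. f i) = (\<Sum>i\<in>I. Z (f i))" if "finite I" for f :: "nat \<Rightarrow> 'r" and I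
    using that by (induction I rule: finite_induct) (auto simp: Z0 add)
  have adj: "(\<Sum>k<n. adj_mat W $$ (j, k) * W $$ (k, l)) = (if j = l then det W else 0)"
    if "l < n" for l
  proof -
    have "(\<Sum>k<n. adj_mat W $$ (j, k) * W $$ (k, l)) = (adj_mat W * W) $$ (j, l)"
      using W j that adj_mat(1)[OF W]
      by (auto simp: times_mat_def scalar_prod_def intro!: sum.cong)
    then show ?thesis using adj_mat(3)[OF W] j that by simp
  qed
  have "(\<Sum>k<n. adj_mat W $$ (j, k) * (\<Sum>l<n. W $$ (k, l) * \<beta> l))
      = (\<Sum>l<n. (\<Sum>k<n. adj_mat W $$ (j, k) * W $$ (k, l)) * \<beta> l)"
    by (simp add: sum_distrib_left sum_distrib_right mult.assoc) (rule sum.swap)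
  also have "\<dots> = (\<Sum>l<n. (if j = l then det W else 0) * \<beta> l)"
    by (rule sum.cong) (simp_all add: adj)
  also have "\<dots> = det W * \<beta> j" using j by (simp add: if_distrib if_distribR sum.delta cong: if_cong)
  finally have eq: "(\<Sum>k<n. adj_mat W $$ (j, k) * (\<Sum>l<n. W $$ (k, l) * \<beta> l)) = det W * \<beta> j" .
  have "Z (det W * \<beta> j)
      = (\<Sum>k<n. Z (adj_mat W $$ (j, k) * (\<Sum>l<n. W $$ (k, l) * \<beta> l)))"
    by (subst eq[symmetric]) (rule Zsum, simp)
  then show ?thesis using rows ideal by simp
qed

section \<open>Relative orders, transversals and abelian quotients\<close>

text \<open>For the least positive \<open>e\<close> with \<open>x [^] e\<close> in \<open>H\<close>,
  the cosets of \<open>H\<close> by the powers of \<open>x\<close> below \<open>e\<close> are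
  disjoint subsets of \<open>H'\<close>, which gives the bound.\<close>

lemma (in group) exists_relative_order:
  assumes fin: "finite (carrier G)" and H: "subgroup H G" and H': "subgroup H' G"
    and sub: "H \<subseteq> H'" and x: "x \<in> H'"
  shows "\<exists>e>0. x [^] (e::nat) \<in> H \<and> e * card H \<le> card H'"
proof -
  define e where "e = (LEAST e. 0 < e \<and> x [^] (e::nat) \<in> H)"
  have xG: "x \<in> carrier G" by (rule subgroup.mem_carrier[OF H' x])
  have ex: "0 < Coset.order G \<and> x [^] Coset.order G \<in> H"
  proof
    show "0 < Coset.order G" using fin order_gt_0_iff_finite by simp
    show "x [^] Coset.order G \<in> H"
      by (subst pow_order_eq_1[OF xG]) (rule subgroup.one_closed[OF H])
  qed
  have "0 < e \<and> x [^] e \<in> H"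
    unfolding e_def by (rule LeastI[where k = "Coset.order G"]) (rule ex)
  then have e: "0 < e" "x [^] e \<in> H" by auto
  have least: "k = 0" if "x [^] k \<in> H" "k < e" for k
    using not_less_Least[of k "\<lambda>e::nat. 0 < e \<and> x [^] e \<in> H"] that by (auto simp: e_def)
  have pow: "x [^] k \<in> H'" for k :: nat
    using H' x by (induction k) (simp_all add: subgroup.m_closed subgroup.one_closed)
  \<comment> \<open>Cancellation puts the power of \<open>x\<close> with exponent
    \<open>k' - k\<close> into \<open>H\<close>; being below \<open>e\<close>, this exponent is
    zero.\<close>
  have diff: "k = k'" "y = y'"
    if yk: "y \<in> H" "y' \<in> H" "k < e" "k' < e" "k \<le> k'" and eq: "y \<otimes> x [^] k = y' \<otimes> x [^] k'" for y y' k k'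
  proof -
    have yG: "y \<in> carrier G" "y' \<in> carrier G" using yk subgroup.mem_carrier[OF H] by auto
    have "y' \<otimes> x [^] k' = y' \<otimes> x [^] (k' - k) \<otimes> x [^] k"
      using yk yG xG by (simp add: m_assoc nat_pow_mult)
    then have y: "y = y' \<otimes> x [^] (k' - k)"
      using eq yG xG by simp
    then have "x [^] (k' - k) = inv y' \<otimes> y"
      using yG xG by (simp add: m_assoc[symmetric])
    also have "\<dots> \<in> H" using yk H by (simp add: subgroup.m_closed subgroup.m_inv_closed)
    finally have "k' - k = 0" by (rule least) (use yk in simp)
    then show kk: "k = k'" using yk by simp
    show "y = y'" using y yG unfolding kk by simp
  qed
  have "inj_on (\<lambda>(y, k). y \<otimes> x [^] k) (H \<times> {..<e})"
  proof (rule inj_onI)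
    fix p p'
    assume p: "p \<in> H \<times> {..<e}" "p' \<in> H \<times> {..<e}"
      and eq: "(case p of (y, k) \<Rightarrow> y \<otimes> x [^] k) = (case p' of (y, k) \<Rightarrow> y \<otimes> x [^] k)"
    obtain y k y' k' where [simp]: "p = (y, k)" "p' = (y', k')" by fastforce
    show "p = p'"
    proof (cases "k \<le> k'")
      case True
      with p eq show ?thesis using diff[of y y' k k'] by simp
    next
      case False
      with p eq[symmetric] show ?thesis using diff[of y' y k' k] by simp
    qed
  qed
  moreover have "(\<lambda>(y, k). y \<otimes> x [^] k) ` (H \<times> {..<e}) \<subseteq> H'"
    by (clarify, intro subgroup.m_closed[OF H'] pow subsetD[OF sub])
  moreover have "finite H'" by (rule finite_subset[OF subgroup.subset[OF H'] fin])
  ultimately have "card (H \<times> {..<e}) \<le> card H'" by (metis card_inj_on_le)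
  then have "e * card H \<le> card H'" by (simp add: card_cartesian_product mult.commute)
  with e show ?thesis by blast
qed

lemma (in group) exists_right_transversal:
  assumes H: "subgroup H G"
  shows "\<exists>T. right_transversal G H T"
proof -
  \<comment> \<open>Choosing by coset rather than by element makes the representative
    unique.\<close>
  define s where "s C = (SOME t. t \<in> carrier G \<and> H #> t = C)" for C
  have s: "s (H #> g) \<in> carrier G \<and> H #> s (H #> g) = H #> g" if "g \<in> carrier G" for g
    unfolding s_def by (rule someI[of _ g]) (use that in simp)
  have "right_transversal G H ((\<lambda>g. s (H #> g)) ` carrier G)"
    unfolding right_transversal_def
  proof (intro conjI ballI)
    fix g assume g: "g \<in> carrier G"
    show "\<exists>!t. t \<in> (\<lambda>g. s (H #> g)) ` carrier G \<and> H #> t = H #> g"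
    proof (rule ex1I[of _ "s (H #> g)"])
      show "s (H #> g) \<in> (\<lambda>g. s (H #> g)) ` carrier G \<and> H #> s (H #> g) = H #> g"
        using s[OF g] g by blast
    next
      fix t assume "t \<in> (\<lambda>g. s (H #> g)) ` carrier G \<and> H #> t = H #> g"
      then show "t = s (H #> g)" using s by force
    qed
  qed (use s in blast)
  then show ?thesis by blast
qed

text \<open>The commutator of \<open>x\<close> and \<open>y\<close> lies in \<open>H\<close>. This
  will make the action of \<open>U\<close> on the splitting module commutative.\<close>

lemma (in normal) rcos_commute:
  assumes "derived G (carrier G) \<subseteq> H" "x \<in> carrier G" "y \<in> carrier G"
  shows "H #> (x \<otimes> y) = H #> (y \<otimes> x)"
proof -
  have "x \<otimes> y \<otimes> inv x \<otimes> inv y \<in> derived_set G (carrier G)"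
    using assms by blast
  then have "x \<otimes> y \<otimes> inv x \<otimes> inv y \<in> H"
    using assms(1) unfolding derived_def by (meson generate.incl subsetD)
  moreover have "x \<otimes> y \<otimes> inv x \<otimes> inv y = (x \<otimes> y) \<otimes> inv (y \<otimes> x)"
    using assms by (simp add: inv_mult_group m_assoc)
  ultimately have "x \<otimes> y \<in> H #> (y \<otimes> x)"
    using assms by (simp add: rcos_module_rev is_group)
  then show ?thesis using assms by (metis m_closed repr_independence subgroup_axioms)
qed

section \<open>Augmentation and polynomials over a group ring\<close>

text \<open>The sum of the coefficients, encoded as the push-forward to the free abelian group on
  one point so that additivity is inherited from \<open>frag_extend\<close>.\<close>

definition aug :: "('c \<Rightarrow>\<^sub>0 int) \<Rightarrow> int" where
  "aug c = Poly_Mapping.lookup (frag_extend (\<lambda>_. frag_of ()) c) ()"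

lemma aug_0 [simp]: "aug 0 = 0"
  and aug_diff: "aug (c - c') = aug c - aug c'"
  and aug_add: "aug (c + c') = aug c + aug c'"
  and aug_minus: "aug (- c) = - aug c"
  and aug_cmul: "aug (frag_cmul k c) = k * aug c"
  and aug_single [simp]: "aug (frag_of m) = 1"
  by (simp_all add: aug_def frag_extend_diff frag_extend_add frag_extend_minus frag_extend_cmul lookup_minus lookup_add)

lemma aug_1 [simp]: "aug (1 :: ('c :: monoid_add) \<Rightarrow>\<^sub>0 int) = 1"
  using aug_single[of "0 :: 'c"] by simp

lemma aug_mult: "aug (c * c') = aug c * aug (c' :: ('c :: monoid_add) \<Rightarrow>\<^sub>0 int)"
proof (induction c rule: frag_induction[OF subset_UNIV])
  case (2 m)
  show ?case
    by (induction c' rule: frag_induction[OF subset_UNIV])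
      (simp_all add: mult_single aug_diff right_diff_distrib)
next
  case (3 c c')
  then show ?case by (simp add: aug_diff left_diff_distrib)
qed simp

lemma aug_sum: "finite I \<Longrightarrow> aug (\<Sum>i\<in>I. f i) = (\<Sum>i\<in>I. aug (f i))"
  by (induction I rule: finite_induct) (auto simp: aug_add)

text \<open>Sets the variable to 0 and every group element to 1. Being a ring homomorphism to the
  integers, it can be applied entrywise under a determinant.\<close>

definition paug :: "(('c :: comm_monoid_add) \<Rightarrow>\<^sub>0 int) poly \<Rightarrow> int" where
  "paug p = aug (Polynomial.coeff p 0)"

interpretation paug: comm_ring_hom "paug :: (('c :: comm_monoid_add) \<Rightarrow>\<^sub>0 int) poly \<Rightarrow> int"
  by unfold_locales (simp_all add: paug_def aug_add coeff_mult_0 aug_mult)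

text \<open>\<open>poly_shift 1\<close> drops the constant term and divides by the variable.\<close>
lemma tail_mult:
  "poly_shift 1 (p * q) = Polynomial.smult (Polynomial.coeff p 0) (poly_shift 1 q) + poly_shift 1 p * (q :: 'r :: comm_ring_1 poly)"
proof (cases p)
  case (pCons a p')
  moreover have "poly_shift 1 (pCons a p') = p'"
    by (rule poly_eqI) (simp add: coeff_poly_shift)
  ultimately show ?thesis
    by (intro poly_eqI) (simp add: coeff_poly_shift)
qed

lemma tail_sum: "finite I \<Longrightarrow> poly_shift 1 (\<Sum>i\<in>I. f i) = (\<Sum>i\<in>I. poly_shift 1 (f i :: 'r :: comm_ring_1 poly))"
  by (rule poly_eqI) (simp add: coeff_poly_shift coeff_sum)

section \<open>The splitting module\<close>

text \<open>The group ring of \<open>U Mod A\<close> is not available as a type of class \<open>comm_ring_1\<close>, which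
  determinants need. Its role is played by the group ring of the free abelian group
  \<open>'a \<Rightarrow>\<^sub>0 int\<close>, which \<open>h\<close> maps onto \<open>U Mod A\<close>.\<close>
locale transfer_setting = normal A U for A :: "'a set" and U :: "('a, 'b) monoid_scheme" (structure) +
  fixes \<gamma> :: "'a \<Rightarrow> 'a" and T :: "'a set" and h :: "('a \<Rightarrow>\<^sub>0 int) \<Rightarrow> 'a set"
  assumes fin: "finite (carrier U)"
    and A_comm: "comm_group (U\<lparr>carrier := A\<rparr>)"
    and derived_sub: "derived U (carrier U) \<subseteq> A"
    and \<gamma>_hom: "\<gamma> \<in> hom U U"
    and A_eq: "A = generate U (derived U (carrier U) \<union>
                         {\<gamma> x \<otimes> inv x | x. x \<in> carrier U})"
    and T: "right_transversal U A T"
    and h_carrier: "h m \<in> rcosets A"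
    and h_add: "h (m + m') = h m <#> h m'"
    and h_frag: "g \<in> carrier U \<Longrightarrow> h (frag_of g) = A #> g"
begin

definition sec :: "'a set \<Rightarrow> 'a" where
  "sec q = (THE t. t \<in> T \<and> A #> t = q)"

definition lmul :: "'a \<Rightarrow> ('a \<Rightarrow>\<^sub>0 int) \<Rightarrow> 'a \<Rightarrow>\<^sub>0 int" where
  "lmul g = frag_extend (\<lambda>x. frag_of (g \<otimes> x))"

definition \<Phi> :: "('a \<Rightarrow>\<^sub>0 int) \<Rightarrow> 'a \<Rightarrow>\<^sub>0 int" where
  "\<Phi> f = frag_extend (\<lambda>x. frag_of (\<gamma> x)) f - f"

definition d :: "'a \<Rightarrow> 'a \<Rightarrow>\<^sub>0 int" where
  "d g = frag_of g - frag_of \<one>"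

text \<open>\<open>V\<close> is the augmentation ideal \<open>I\<^sub>U\<close> of the integral group ring of \<open>U\<close>, and \<open>K\<close> is
  \<open>I\<^sub>A I\<^sub>U\<close>. The quotient \<open>V / K\<close> is Artin's splitting module; on it \<open>A\<close> acts trivially.\<close>
inductive_set V :: "('a \<Rightarrow>\<^sub>0 int) set" where
  V_zero: "0 \<in> V"
| V_d: "g \<in> carrier U \<Longrightarrow> d g \<in> V"
| V_diff: "f \<in> V \<Longrightarrow> f' \<in> V \<Longrightarrow> f - f' \<in> V"

inductive_set K :: "('a \<Rightarrow>\<^sub>0 int) set" where
  K_zero: "0 \<in> K"
| K_gen: "a \<in> A \<Longrightarrow> g \<in> carrier U \<Longrightarrow> lmul a (d g) - d g \<in> K"
| K_diff: "f \<in> K \<Longrightarrow> f' \<in> K \<Longrightarrow> f - f' \<in> K"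

definition cong_K :: "('a \<Rightarrow>\<^sub>0 int) \<Rightarrow> ('a \<Rightarrow>\<^sub>0 int) \<Rightarrow> bool" (infix "\<approx>\<^sub>K" 50) where
  "f \<approx>\<^sub>K f' \<longleftrightarrow> f - f' \<in> K"

lemma K_minus: "f \<in> K \<Longrightarrow> - f \<in> K"
  using K_diff[OF K_zero, of f] by simp

lemma K_add: "f \<in> K \<Longrightarrow> f' \<in> K \<Longrightarrow> f + f' \<in> K"
  using K_diff[of f "- f'"] K_minus[of f'] by simp

lemma V_minus: "f \<in> V \<Longrightarrow> - f \<in> V"
  using V_diff[OF V_zero, of f] by simp

lemma V_add: "f \<in> V \<Longrightarrow> f' \<in> V \<Longrightarrow> f + f' \<in> V"
  using V_diff[of f "- f'"] V_minus[of f'] by simp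

lemma K_sum: "finite I \<Longrightarrow> (\<And>i. i \<in> I \<Longrightarrow> f i \<in> K) \<Longrightarrow> (\<Sum>i\<in>I. f i) \<in> K"
  by (induction I rule: finite_induct) (auto intro: K_zero K_add)

lemma V_sum: "finite I \<Longrightarrow> (\<And>i. i \<in> I \<Longrightarrow> f i \<in> V) \<Longrightarrow> (\<Sum>i\<in>I. f i) \<in> V"
  by (induction I rule: finite_induct) (auto intro: V_zero V_add)

lemma cong_refl [simp]: "f \<approx>\<^sub>K f"
  by (simp add: cong_K_def K_zero)

lemma cong_sym: "f \<approx>\<^sub>K f' \<Longrightarrow> f' \<approx>\<^sub>K f"
  using K_minus by (fastforce simp: cong_K_def)

lemma cong_trans [trans]: "f \<approx>\<^sub>K f' \<Longrightarrow> f' \<approx>\<^sub>K f'' \<Longrightarrow> f \<approx>\<^sub>K f''"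
  using K_add by (fastforce simp: cong_K_def)

lemma cong_add: "f \<approx>\<^sub>K f' \<Longrightarrow> e \<approx>\<^sub>K e' \<Longrightarrow> f + e \<approx>\<^sub>K f' + e'"
  using K_add[of "f - f'" "e - e'"] by (simp add: cong_K_def algebra_simps)

lemma cong_diff: "f \<approx>\<^sub>K f' \<Longrightarrow> e \<approx>\<^sub>K e' \<Longrightarrow> f - e \<approx>\<^sub>K f' - e'"
  using K_diff[of "f - f'" "e - e'"] by (simp add: cong_K_def algebra_simps)

lemma cong_sum:
  "finite I \<Longrightarrow> (\<And>i. i \<in> I \<Longrightarrow> f i \<approx>\<^sub>K f' i) \<Longrightarrow> (\<Sum>i\<in>I. f i) \<approx>\<^sub>K (\<Sum>i\<in>I. f' i)"
  by (induction I rule: finite_induct) (auto intro: cong_add)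

lemma cong_K_iff: "f \<approx>\<^sub>K f' \<Longrightarrow> f \<in> K \<longleftrightarrow> f' \<in> K"
  using K_add[of "f - f'" f'] K_diff[of f "f - f'"] by (auto simp: cong_K_def)

lemma lmul_diff: "lmul g (f - f') = lmul g f - lmul g f'"
  and lmul_add: "lmul g (f + f') = lmul g f + lmul g f'"
  and lmul_0 [simp]: "lmul g 0 = 0"
  and lmul_of [simp]: "lmul g (frag_of x) = frag_of (g \<otimes> x)"
  by (simp_all add: lmul_def frag_extend_diff frag_extend_add)

lemma \<Phi>_diff: "\<Phi> (f - f') = \<Phi> f - \<Phi> f'"
  and \<Phi>_add: "\<Phi> (f + f') = \<Phi> f + \<Phi> f'"
  and \<Phi>_0 [simp]: "\<Phi> 0 = 0"
  by (simp_all add: \<Phi>_def frag_extend_diff frag_extend_add)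

lemma \<gamma>_closed [simp, intro]: "g \<in> carrier U \<Longrightarrow> \<gamma> g \<in> carrier U"
  using \<gamma>_hom by (auto simp: hom_def)

lemma \<gamma>_mult: "g \<in> carrier U \<Longrightarrow> g' \<in> carrier U \<Longrightarrow> \<gamma> (g \<otimes> g') = \<gamma> g \<otimes> \<gamma> g'"
  using \<gamma>_hom by (auto simp: hom_def)

lemma \<gamma>_one [simp]: "\<gamma> \<one> = \<one>"
  using \<gamma>_hom by (simp add: hom_one)

lemma \<Phi>_d: "\<Phi> (d g) = d (\<gamma> g) - d g"
  by (simp add: \<Phi>_def d_def frag_extend_diff)

lemma lmul_d: "g \<in> carrier U \<Longrightarrow> lmul g (d x) = d (g \<otimes> x) - d g"
  by (simp add: d_def lmul_diff)

lemma d_one [simp]: "d \<one> = 0"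
  by (simp add: d_def)

lemma \<gamma>_inv_mem: "x \<in> carrier U \<Longrightarrow> \<gamma> x \<otimes> inv x \<in> A"
  by (subst A_eq) (auto intro: generate.incl)

text \<open>The elements \<open>\<gamma> x \<otimes> inv x\<close> lie in \<open>A\<close>, so
  \<open>\<gamma>\<close> acts trivially on \<open>U Mod A\<close>. This makes \<open>\<Phi>\<close>
  linear over the group ring of the quotient, modulo \<open>K\<close>.\<close>

lemma coset_\<gamma>: "x \<in> carrier U \<Longrightarrow> A #> \<gamma> x = A #> x"
  using \<gamma>_inv_mem[of x] by (metis \<gamma>_closed rcos_module_rev is_group repr_independence subgroup_axioms)

lemma sec:
  assumes "q \<in> rcosets A"
  shows "sec q \<in> T" "sec q \<in> carrier U" "A #> sec q = q"
proof -
  obtain g where g: "g \<in> carrier U" "q = A #> g" using assms by (auto simp: RCOSETS_def)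
  have "\<exists>!t. t \<in> T \<and> A #> t = q" using T g by (auto simp: right_transversal_def)
  from theI'[OF this] show "sec q \<in> T" "A #> sec q = q" by (auto simp: sec_def)
  then show "sec q \<in> carrier U" using T by (auto simp: right_transversal_def)
qed

lemma sec_coset: "t \<in> T \<Longrightarrow> sec (A #> t) = t"
  using T unfolding right_transversal_def sec_def by (intro the_equality) blast+

lemma lmul_V: "f \<in> V \<Longrightarrow> g \<in> carrier U \<Longrightarrow> lmul g f \<in> V"
  by (induction f rule: V.induct, unfold lmul_diff) (auto intro: V.intros simp: lmul_d)

lemma \<Phi>_V: "f \<in> V \<Longrightarrow> \<Phi> f \<in> V"
  by (induction f rule: V.induct, unfold \<Phi>_diff) (auto intro: V.intros simp: \<Phi>_d)

lemma lmul_lmul: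
  assumes "g \<in> carrier U" "g' \<in> carrier U" "f \<in> V"
  shows "lmul g (lmul g' f) = lmul (g \<otimes> g') f"
  using assms(3)
proof (induction f rule: V.induct)
  case (V_diff f f')
  then show ?case by (simp only: lmul_diff)
qed (use assms in \<open>simp_all add: d_def lmul_diff m_assoc\<close>)

lemma lmul_A: "f \<in> V \<Longrightarrow> a \<in> A \<Longrightarrow> lmul a f \<approx>\<^sub>K f"
proof (induction f rule: V.induct)
  case (V_diff f f')
  then show ?case by (simp only: lmul_diff cong_diff)
qed (auto simp: cong_K_def intro: K.intros)

lemma K_V: "f \<in> K \<Longrightarrow> f \<in> V"
  by (induction f rule: K.induct) (auto intro: V.intros lmul_V mem_carrier)

lemma coset_cases:
  assumes "g \<in> carrier U" "g' \<in> carrier U" "A #> g = A #> g'"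
  obtains a where "a \<in> A" "g = a \<otimes> g'"
  using assms rcos_self[OF assms(1) subgroup_axioms] by (auto simp: r_coset_def)

text \<open>The two elements differ by a factor in \<open>A\<close>, which acts trivially modulo
  \<open>K\<close>. Thus \<open>U Mod A\<close> acts on \<open>V\<close> modulo
  \<open>K\<close>.\<close>

lemma lmul_cong:
  assumes "g \<in> carrier U" "g' \<in> carrier U" "A #> g = A #> g'" "f \<in> V"
  shows "lmul g f \<approx>\<^sub>K lmul g' f"
proof -
  obtain a where a: "a \<in> A" "g = a \<otimes> g'" using coset_cases assms by metis
  then show ?thesis using lmul_A[OF lmul_V[OF assms(4,2)] a(1)] assms by (simp add: lmul_lmul)
qed

lemma lmul_commute:
  assumes "g \<in> carrier U" "g' \<in> carrier U" "f \<in> V"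
  shows "lmul g (lmul g' f) \<approx>\<^sub>K lmul g' (lmul g f)"
  using assms rcos_commute[OF derived_sub, of g g'] by (simp add: lmul_lmul lmul_cong)

text \<open>Modulo \<open>K\<close>, \<open>g\<close> can be moved past \<open>a\<close>, and then
  \<open>a\<close> acts trivially on \<open>lmul g (d x)\<close>; so \<open>g\<close> maps each
  generator of \<open>K\<close> into \<open>K\<close>.\<close>

lemma lmul_K: "f \<in> K \<Longrightarrow> g \<in> carrier U \<Longrightarrow> lmul g f \<in> K"
proof (induction f rule: K.induct)
  case (K_gen a x)
  then have "lmul g (lmul a (d x)) \<approx>\<^sub>K lmul a (lmul g (d x))"
    by (intro lmul_commute) (auto intro: V.intros)
  also have "\<dots> \<approx>\<^sub>K lmul g (d x)" using K_gen by (intro lmul_A lmul_V V.intros)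
  finally show ?case by (simp add: lmul_diff cong_K_def)
qed (auto simp: lmul_diff intro: K.intros)

text \<open>\<open>\<gamma>\<close> is multiplicative, and \<open>\<gamma> g\<close> lies in the
  same coset as \<open>g\<close>.\<close>

lemma \<Phi>_lmul:
  assumes "g \<in> carrier U" "f \<in> V"
  shows "\<Phi> (lmul g f) \<approx>\<^sub>K lmul g (\<Phi> f)"
proof -
  \<comment> \<open>\<open>\<Phi> f + f\<close> is the linear extension of \<open>\<gamma>\<close>
    applied to \<open>f\<close>.\<close>
  have eq: "\<Phi> (lmul g f) = lmul (\<gamma> g) (\<Phi> f + f) - lmul g f"
    using assms(2)
  proof (induction f rule: V.induct)
    case (V_diff f f')
    have "\<Phi> (f - f') + (f - f') = (\<Phi> f + f) - (\<Phi> f' + f')" by (simp add: \<Phi>_diff)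
    then have "lmul (\<gamma> g) (\<Phi> (f - f') + (f - f'))
        = lmul (\<gamma> g) (\<Phi> f + f) - lmul (\<gamma> g) (\<Phi> f' + f')"
      by (simp only: lmul_diff)
    moreover have "\<Phi> (lmul g (f - f')) = \<Phi> (lmul g f) - \<Phi> (lmul g f')"
      by (simp only: lmul_diff \<Phi>_diff)
    ultimately show ?case using V_diff.IH by (simp only: lmul_diff diff_diff_eq2) simp
  qed (use assms in \<open>simp_all add: d_def \<Phi>_def lmul_diff frag_extend_diff \<gamma>_mult\<close>)
  have "lmul (\<gamma> g) (\<Phi> f + f) \<approx>\<^sub>K lmul g (\<Phi> f + f)"
    using assms by (intro lmul_cong coset_\<gamma> V_add \<Phi>_V) auto
  then have "\<Phi> (lmul g f) \<approx>\<^sub>K lmul g (\<Phi> f + f) - lmul g f"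
    unfolding eq by (rule cong_diff) simp
  then show ?thesis by (simp flip: lmul_diff)
qed

lemma \<Phi>_K: "f \<in> K \<Longrightarrow> \<Phi> f \<in> K"
proof (induction f rule: K.induct)
  case (K_gen a x)
  then have "\<Phi> (lmul a (d x)) \<approx>\<^sub>K lmul a (\<Phi> (d x))"
    by (intro \<Phi>_lmul) (auto intro: V.intros)
  also have "\<dots> \<approx>\<^sub>K \<Phi> (d x)" using K_gen by (intro lmul_A \<Phi>_V V.intros)
  finally show ?case by (simp add: \<Phi>_diff cong_K_def)
qed (auto simp: \<Phi>_diff intro: K.intros)

section \<open>The action of polynomials over the group ring\<close>

text \<open>Group ring elements act through coset representatives. This is additive exactly, but
  multiplicative only modulo \<open>K\<close> on \<open>V\<close>, since representatives multiply
  only up to factors in \<open>A\<close>.\<close>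

definition ract :: "(('a \<Rightarrow>\<^sub>0 int) \<Rightarrow>\<^sub>0 int) \<Rightarrow> ('a \<Rightarrow>\<^sub>0 int) \<Rightarrow> 'a \<Rightarrow>\<^sub>0 int" where
  "ract c f = frag_extend (\<lambda>m. lmul (sec (h m)) f) c"

text \<open>The map of integral group rings induced by \<open>h\<close>, with the group ring of
  \<open>U Mod A\<close> kept as a free abelian group on cosets.\<close>

definition \<zeta> :: "(('a \<Rightarrow>\<^sub>0 int) \<Rightarrow>\<^sub>0 int) \<Rightarrow> 'a set \<Rightarrow>\<^sub>0 int" where
  "\<zeta> = frag_extend (\<lambda>m. frag_of (h m))"

definition \<epsilon> :: "('a \<Rightarrow>\<^sub>0 int) \<Rightarrow> 'a set \<Rightarrow>\<^sub>0 int" where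
  "\<epsilon> = frag_extend (\<lambda>x. frag_of (A #> x))"

text \<open>The polynomial variable acts as \<open>\<Phi>\<close>, that is, as \<open>\<gamma> - 1\<close>.\<close>
definition act :: "(('a \<Rightarrow>\<^sub>0 int) \<Rightarrow>\<^sub>0 int) poly \<Rightarrow> ('a \<Rightarrow>\<^sub>0 int) \<Rightarrow> 'a \<Rightarrow>\<^sub>0 int" where
  "act p f = (\<Sum>k\<le>Polynomial.degree p. ract (Polynomial.coeff p k) ((\<Phi> ^^ k) f))"

lemma sec_h [simp, intro]: "sec (h m) \<in> carrier U"
  and sec_h_coset [simp]: "A #> sec (h m) = h m"
  using sec h_carrier by auto

lemma ract_0 [simp]: "ract 0 f = 0" "ract c 0 = 0"
  and ract_diff_left: "ract (c - c') f = ract c f - ract c' f"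
  and ract_add_left: "ract (c + c') f = ract c f + ract c' f"
  and ract_single [simp]: "ract (frag_of m) f = lmul (sec (h m)) f"
  by (simp_all add: ract_def frag_extend_diff frag_extend_add frag_extend_eq_0)

lemma ract_diff: "ract c (f - f') = ract c f - ract c f'"
  by (induction c rule: frag_induction[OF subset_UNIV])
    (simp_all add: ract_diff_left lmul_diff algebra_simps)

lemma ract_add: "ract c (f + f') = ract c f + ract c f'"
  by (induction c rule: frag_induction[OF subset_UNIV])
    (simp_all add: ract_diff_left lmul_add algebra_simps)

lemma ract_V: "f \<in> V \<Longrightarrow> ract c f \<in> V"
  by (induction c rule: frag_induction[OF subset_UNIV])
    (auto simp: ract_diff_left intro: V_zero V_diff lmul_V)

lemma ract_K: "f \<in> K \<Longrightarrow> ract c f \<in> K"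
  by (induction c rule: frag_induction[OF subset_UNIV])
    (auto simp: ract_diff_left intro: K_zero K_diff lmul_K)

lemma ract_mult_single:
  assumes "f \<in> V"
  shows "ract (frag_of m * c) f \<approx>\<^sub>K lmul (sec (h m)) (ract c f)"
proof (induction c rule: frag_induction[OF subset_UNIV])
  case (2 m')
  have "lmul (sec (h (m + m'))) f \<approx>\<^sub>K lmul (sec (h m) \<otimes> sec (h m')) f"
  proof (rule lmul_cong)
    show "A #> sec (h (m + m')) = A #> (sec (h m) \<otimes> sec (h m'))"
      unfolding rcos_sum[OF sec_h sec_h, symmetric] sec_h_coset by (rule h_add)
  qed (use assms in auto)
  then show ?case using assms by (simp add: mult_single lmul_lmul)
next
  case (3 c c')
  then show ?case by (simp add: right_diff_distrib ract_diff_left lmul_diff cong_diff)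
qed simp

lemma ract_mult: "f \<in> V \<Longrightarrow> ract (c * c') f \<approx>\<^sub>K ract c (ract c' f)"
proof (induction c rule: frag_induction[OF subset_UNIV])
  case (2 m)
  then show ?case by (simp add: ract_mult_single)
next
  case (3 c c')
  then show ?case by (simp add: left_diff_distrib ract_diff_left cong_diff)
qed simp

lemma ract_\<Phi>: "f \<in> V \<Longrightarrow> ract c (\<Phi> f) \<approx>\<^sub>K \<Phi> (ract c f)"
proof (induction c rule: frag_induction[OF subset_UNIV])
  case (2 m)
  then show ?case by (simp add: \<Phi>_lmul cong_sym)
next
  case (3 c c')
  then show ?case by (simp add: \<Phi>_diff ract_diff_left cong_diff)
qed simp

lemma \<Phi>_pow_0 [simp]: "(\<Phi> ^^ k) 0 = 0"
  by (induction k) auto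

lemma \<Phi>_pow_add: "(\<Phi> ^^ k) (f + f') = (\<Phi> ^^ k) f + (\<Phi> ^^ k) f'"
  by (induction k) (auto simp: \<Phi>_add)

lemma \<Phi>_pow_diff: "(\<Phi> ^^ k) (f - f') = (\<Phi> ^^ k) f - (\<Phi> ^^ k) f'"
  by (induction k) (auto simp: \<Phi>_diff)

lemma act_upto:
  assumes "Polynomial.degree p \<le> n"
  shows "act p f = (\<Sum>k\<le>n. ract (Polynomial.coeff p k) ((\<Phi> ^^ k) f))"
  unfolding act_def using assms
  by (intro sum.mono_neutral_left) (auto simp: coeff_eq_0)

lemma act_0 [simp]: "act 0 f = 0" "act p 0 = 0"
  by (simp_all add: act_def)

lemma act_add_left: "act (p + q) f = act p f + act q f"
proof -
  let ?n = "max (Polynomial.degree p) (Polynomial.degree q)"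
  have "act (p + q) f = (\<Sum>k\<le>?n. ract (Polynomial.coeff (p + q) k) ((\<Phi> ^^ k) f))"
    by (rule act_upto) (rule degree_add_le_max)
  then show ?thesis
    by (simp add: act_upto[of p ?n] act_upto[of q ?n] ract_add_left sum.distrib)
qed

lemma act_minus_left: "act (- p) f = - act p f"
  using act_add_left[of p "- p" f] by (simp add: eq_neg_iff_add_eq_0 add.commute)

lemma act_diff_left: "act (p - q) f = act p f - act q f"
  using act_add_left[of p "- q" f] by (simp add: act_minus_left)

lemma act_sum_left: "finite I \<Longrightarrow> act (\<Sum>i\<in>I. p i) f = (\<Sum>i\<in>I. act (p i) f)"
  by (induction I rule: finite_induct) (auto simp: act_add_left)

lemma act_add: "act p (f + f') = act p f + act p f'"
  by (simp add: act_def \<Phi>_pow_add ract_add sum.distrib)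

lemma act_diff: "act p (f - f') = act p f - act p f'"
  by (simp add: act_def \<Phi>_pow_diff ract_diff sum_subtractf)

lemma act_sum: "finite I \<Longrightarrow> act p (\<Sum>i\<in>I. f i) = (\<Sum>i\<in>I. act p (f i))"
  by (induction I rule: finite_induct) (auto simp: act_add)

text \<open>A Horner recursion. Since \<open>f\<close> becomes \<open>\<Phi> f\<close>, the
  inductions over polynomials below generalize \<open>f\<close>.\<close>

lemma act_pCons: "act (pCons c p) f = ract c f + act p (\<Phi> f)"
proof -
  have "act (pCons c p) f
      = (\<Sum>k\<le>Suc (Polynomial.degree p). ract (Polynomial.coeff (pCons c p) k) ((\<Phi> ^^ k) f))"
    by (rule act_upto) (rule degree_pCons_le)
  then show ?thesis
    by (simp add: sum.atMost_Suc_shift act_def funpow_swap1 del: sum.atMost_Suc)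
qed

lemma act_V: "f \<in> V \<Longrightarrow> act p f \<in> V"
  by (induction p arbitrary: f) (auto simp: act_pCons intro: V_zero V_add ract_V \<Phi>_V)

lemma act_K: "f \<in> K \<Longrightarrow> act p f \<in> K"
  by (induction p arbitrary: f) (auto simp: act_pCons intro: K_zero K_add ract_K \<Phi>_K)

lemma act_cong: "f \<approx>\<^sub>K f' \<Longrightarrow> act p f \<approx>\<^sub>K act p f'"
  using act_K[of "f - f'" p] by (simp add: cong_K_def act_diff)

lemma act_\<Phi>: "f \<in> V \<Longrightarrow> act p (\<Phi> f) \<approx>\<^sub>K \<Phi> (act p f)"
proof (induction p arbitrary: f)
  case (pCons c p)
  then show ?case by (simp add: act_pCons \<Phi>_add \<Phi>_V cong_add ract_\<Phi>)
qed simp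

lemma act_smult: "f \<in> V \<Longrightarrow> act (Polynomial.smult c p) f \<approx>\<^sub>K ract c (act p f)"
proof (induction p arbitrary: f)
  case (pCons c' p)
  then show ?case by (simp add: act_pCons ract_add \<Phi>_V cong_add ract_mult)
qed simp

lemma act_mult: "f \<in> V \<Longrightarrow> act (p * q) f \<approx>\<^sub>K act p (act q f)"
proof (induction p arbitrary: f)
  case (pCons c p)
  have "act (p * q) (\<Phi> f) \<approx>\<^sub>K act p (act q (\<Phi> f))"
    using pCons by (simp add: \<Phi>_V)
  also have "\<dots> \<approx>\<^sub>K act p (\<Phi> (act q f))"
    using pCons by (intro act_cong act_\<Phi>)
  finally show ?case
    using pCons by (simp add: act_add_left act_pCons cong_add act_smult)
qed simp

lemma act_const: "act [:c:] f = ract c f"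
  by (simp add: act_pCons)

section \<open>Projection to the group ring of the quotient\<close>

lemma \<zeta>_0 [simp]: "\<zeta> 0 = 0"
  and \<zeta>_diff: "\<zeta> (c - c') = \<zeta> c - \<zeta> c'"
  and \<zeta>_add: "\<zeta> (c + c') = \<zeta> c + \<zeta> c'"
  and \<zeta>_single [simp]: "\<zeta> (frag_of m) = frag_of (h m)"
  by (simp_all add: \<zeta>_def frag_extend_diff frag_extend_add)

lemma \<epsilon>_0 [simp]: "\<epsilon> 0 = 0"
  and \<epsilon>_diff: "\<epsilon> (f - f') = \<epsilon> f - \<epsilon> f'"
  and \<epsilon>_add: "\<epsilon> (f + f') = \<epsilon> f + \<epsilon> f'"
  and \<epsilon>_single [simp]: "\<epsilon> (frag_of x) = frag_of (A #> x)"
  by (simp_all add: \<epsilon>_def frag_extend_diff frag_extend_add)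

lemma \<epsilon>_sum: "finite I \<Longrightarrow> \<epsilon> (\<Sum>i\<in>I. f i) = (\<Sum>i\<in>I. \<epsilon> (f i))"
  by (induction I rule: finite_induct) (auto simp: \<epsilon>_add)

lemma \<zeta>_sum: "finite I \<Longrightarrow> \<zeta> (\<Sum>i\<in>I. f i) = (\<Sum>i\<in>I. \<zeta> (f i))"
  by (induction I rule: finite_induct) (auto simp: \<zeta>_add)

text \<open>Hence the action of \<open>c\<close> depends only on its image in the group ring of
  \<open>U Mod A\<close>, and an element killed by \<open>\<zeta>\<close> acts as zero exactly, not
  just modulo \<open>K\<close>.\<close>

lemma ract_\<zeta>: "ract c f = frag_extend (\<lambda>q. lmul (sec q) f) (\<zeta> c)"
  by (induction c rule: frag_induction[OF subset_UNIV])
    (simp_all add: ract_diff_left \<zeta>_diff frag_extend_diff)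

lemma \<epsilon>_K: "f \<in> K \<Longrightarrow> \<epsilon> f = 0"
proof (induction f rule: K.induct)
  case (K_gen a g)
  have "A #> (a \<otimes> g) = (A #> a) #> g"
    using K_gen by (simp add: coset_mult_assoc subset)
  then show ?case using K_gen
    by (simp add: d_def lmul_diff \<epsilon>_diff coset_join2 subgroup_axioms subset)
qed (simp_all add: \<epsilon>_diff)

lemma \<epsilon>_\<Phi>: "f \<in> V \<Longrightarrow> \<epsilon> (\<Phi> f) = 0"
proof (induction f rule: V.induct)
  case (V_d g)
  then have "\<epsilon> (d (\<gamma> g)) = \<epsilon> (d g)" by (simp add: d_def \<epsilon>_diff coset_\<gamma>)
  then show ?case by (simp add: \<Phi>_d \<epsilon>_diff)
qed (simp_all add: \<Phi>_diff \<epsilon>_diff)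

lemma \<epsilon>_ract_d:
  assumes "g \<in> carrier U"
  shows "\<epsilon> (ract c (d g)) = \<zeta> (c * (frag_of (frag_of g) - 1))"
proof (induction c rule: frag_induction[OF subset_UNIV])
  case (2 m)
  have "A #> (sec (h m) \<otimes> g) = h (m + frag_of g)"
    using assms by (simp add: h_add h_frag flip: rcos_sum)
  then show ?case using assms
    by (simp add: d_def lmul_diff \<epsilon>_diff right_diff_distrib \<zeta>_diff mult_single)
next
  case (3 c c')
  then show ?case by (simp add: ract_diff_left \<epsilon>_diff left_diff_distrib \<zeta>_diff)
qed simp

text \<open>Modulo \<open>K\<close>, the higher terms of \<open>p\<close> land in the image of
  \<open>\<Phi>\<close>, which \<open>\<epsilon>\<close> kills, so only the constant coefficient
  survives. This turns relations modulo \<open>K\<close> into relations over the group ring of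
  \<open>U Mod A\<close>.\<close>

lemma \<epsilon>_act_d:
  assumes "g \<in> carrier U"
  shows "\<epsilon> (act p (d g)) = \<zeta> (Polynomial.coeff p 0 * (frag_of (frag_of g) - 1))"
proof (cases p)
  case (pCons c p')
  have "\<epsilon> (act p' (\<Phi> (d g)) - \<Phi> (act p' (d g))) = 0"
    using act_\<Phi>[of "d g" p'] assms by (simp add: cong_K_def V_d \<epsilon>_K)
  then show ?thesis
    using pCons assms by (simp add: act_pCons \<epsilon>_add \<epsilon>_diff \<epsilon>_ract_d \<epsilon>_\<Phi> act_V V_d)
qed

lemma \<zeta>_mult_single: "\<zeta> (frag_of m * c) = frag_extend (\<lambda>q. frag_of (h m <#> q)) (\<zeta> c)"
  by (induction c rule: frag_induction[OF subset_UNIV])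
    (simp_all add: mult_single h_add \<zeta>_diff frag_extend_diff right_diff_distrib)

text \<open>Multiplying \<open>c\<close> by a monomial only moves the cosets in
  \<open>\<zeta> c\<close>; the general case follows by linearity in \<open>c'\<close>.\<close>

lemma \<zeta>_ideal: "\<zeta> c = 0 \<Longrightarrow> \<zeta> (c' * c) = 0"
  by (induction c' rule: frag_induction[OF subset_UNIV])
    (simp_all add: \<zeta>_mult_single \<zeta>_diff left_diff_distrib)

section \<open>Relations between the generators\<close>

abbreviation mon :: "'a \<Rightarrow> ('a \<Rightarrow>\<^sub>0 int) \<Rightarrow>\<^sub>0 int" where
  "mon g \<equiv> frag_of (frag_of g)"

text \<open>All elements of \<open>U\<close> are listed, so that every \<open>d g\<close> is itself
  one of the \<open>b j\<close>.\<close>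

definition gens :: "'a list" where
  "gens = (SOME xs. set xs = carrier U)"

definition b :: "nat \<Rightarrow> 'a \<Rightarrow>\<^sub>0 int" where
  "b j = d (gens ! j)"

abbreviation N :: nat where
  "N \<equiv> length gens"

definition comb :: "(nat \<Rightarrow> (('a \<Rightarrow>\<^sub>0 int) \<Rightarrow>\<^sub>0 int) poly) \<Rightarrow> 'a \<Rightarrow>\<^sub>0 int" where
  "comb v = (\<Sum>j<N. act (v j) (b j))"

definition comb_span :: "(('a \<Rightarrow>\<^sub>0 int) \<Rightarrow>\<^sub>0 int) poly set \<Rightarrow> ('a \<Rightarrow>\<^sub>0 int) set" where
  "comb_span J = {f. \<exists>v. range v \<subseteq> J \<and> f \<approx>\<^sub>K comb v}"

text \<open>A condition on sets of coefficients with two instances: the polynomials with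
  \<open>paug p = 0\<close>, which include the variable, and the constants of augmentation zero,
  which do not.\<close>

definition admissible :: "(('a \<Rightarrow>\<^sub>0 int) \<Rightarrow>\<^sub>0 int) poly set \<Rightarrow> bool" where
  "admissible J \<longleftrightarrow> 0 \<in> J \<and> (\<forall>p\<in>J. \<forall>q\<in>J. p - q \<in> J) \<and> (\<forall>g\<in>carrier U. [:mon g - 1:] \<in> J)"

lemma set_gens: "set gens = carrier U"
  unfolding gens_def by (rule someI_ex[OF finite_list[OF fin]])

lemma gens_carrier [simp, intro]: "j < N \<Longrightarrow> gens ! j \<in> carrier U"
  using nth_mem[of j gens] by (simp add: set_gens)

lemma b_V [intro]: "j < N \<Longrightarrow> b j \<in> V"
  by (simp add: b_def V_d)

lemma obtain_index:
  assumes "g \<in> carrier U"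
  obtains j where "j < N" "gens ! j = g" "b j = d g"
  using assms set_gens by (metis b_def in_set_conv_nth)

text \<open>\<open>h 0\<close> is idempotent in the group \<open>U Mod A\<close>, hence its
  identity.\<close>

lemma h_0: "h 0 = A"
proof -
  have "A #> sec (h 0) = A #> (sec (h 0) \<otimes> sec (h 0))"
    using h_add[of 0 0] by (simp flip: rcos_sum)
  then have "A #> (sec (h 0) \<otimes> sec (h 0) \<otimes> inv sec (h 0)) = A"
    by (metis coset_mult_inv2 m_closed sec_h subset)
  moreover have "sec (h 0) \<otimes> sec (h 0) \<otimes> inv sec (h 0) = sec (h 0)"
    by (simp add: m_assoc)
  ultimately show ?thesis by (simp only: sec_h_coset)
qed

lemma lmul_one: "f \<in> V \<Longrightarrow> lmul \<one> f = f"
proof (induction f rule: V.induct)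
  case (V_diff f f')
  then show ?case by (simp only: lmul_diff)
qed (simp_all add: lmul_d)

lemma lmul_sec:
  assumes "g \<in> carrier U" "f \<in> V"
  shows "lmul (sec (A #> g)) f \<approx>\<^sub>K lmul g f"
  using assms by (intro lmul_cong) (auto simp: sec rcosetsI subset)

lemma ract_1: "f \<in> V \<Longrightarrow> ract 1 f \<approx>\<^sub>K f"
  using lmul_sec[of \<one> f] lmul_one[of f] ract_single[of 0 f]
  by (simp add: h_0 subset)

lemma ract_X: "g \<in> carrier U \<Longrightarrow> f \<in> V \<Longrightarrow> ract (mon g) f \<approx>\<^sub>K lmul g f"
  by (simp add: h_frag lmul_sec)

lemma act_T: "f \<in> V \<Longrightarrow> act [:0, 1:] f \<approx>\<^sub>K \<Phi> f"
  by (simp add: act_pCons ract_1 \<Phi>_V)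

lemma comb_diff: "comb (\<lambda>j. v j - w j) = comb v - comb w"
  by (simp add: comb_def act_diff_left sum_subtractf)

lemma comb_span_cong: "f \<approx>\<^sub>K f' \<Longrightarrow> f' \<in> comb_span J \<Longrightarrow> f \<in> comb_span J"
  unfolding comb_span_def using cong_trans by blast

lemma comb_span_0: "admissible J \<Longrightarrow> 0 \<in> comb_span J"
  unfolding comb_span_def admissible_def comb_def
  by (auto intro!: exI[of _ "\<lambda>_. 0"])

lemma comb_span_diff:
  assumes "admissible J" "f \<in> comb_span J" "f' \<in> comb_span J"
  shows "f - f' \<in> comb_span J"
proof -
  obtain v w where "range v \<subseteq> J" "f \<approx>\<^sub>K comb v" "range w \<subseteq> J" "f' \<approx>\<^sub>K comb w"
    using assms by (auto simp: comb_span_def)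
  then have "range (\<lambda>j. v j - w j) \<subseteq> J" "f - f' \<approx>\<^sub>K comb (\<lambda>j. v j - w j)"
    using assms(1) by (auto simp: admissible_def comb_diff intro: cong_diff)
  then show ?thesis by (auto simp: comb_span_def)
qed

lemma comb_span_minus: "admissible J \<Longrightarrow> f \<in> comb_span J \<Longrightarrow> - f \<in> comb_span J"
  using comb_span_diff[of J 0 f] by (simp add: comb_span_0)

lemma comb_span_add: "admissible J \<Longrightarrow> f \<in> comb_span J \<Longrightarrow> f' \<in> comb_span J \<Longrightarrow> f + f' \<in> comb_span J"
  using comb_span_diff[of J f "- f'"] by (simp add: comb_span_minus)

lemma act_in_comb_span:
  assumes "admissible J" "p \<in> J" "g \<in> carrier U"
  shows "act p (d g) \<in> comb_span J"
proof -
  obtain i where i: "i < N" "b i = d g" using assms by (metis obtain_index)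
  \<comment> \<open>\<open>gens\<close> may repeat \<open>g\<close>, so the coefficient sits at one
    chosen index.\<close>
  let ?v = "\<lambda>j. if j = i then p else 0"
  have "comb ?v = (\<Sum>j<N. if j = i then act p (d g) else 0)"
    unfolding comb_def using i by (intro sum.cong) auto
  also have "\<dots> = act p (d g)" using i by (simp add: sum.delta)
  finally have "act p (d g) \<approx>\<^sub>K comb ?v" by simp
  moreover have "range ?v \<subseteq> J" using assms by (auto simp: admissible_def)
  ultimately show ?thesis unfolding comb_span_def by blast
qed

text \<open>The defect is \<open>g - 1\<close> applied to \<open>d g'\<close>, with an admissible
  coefficient. So \<open>d\<close> is a homomorphism modulo \<open>comb_span J\<close>, which
  governs inverses, commutators and powers below.\<close>

lemma d_mult:
  assumes J: "admissible J" and g: "g \<in> carrier U" "g' \<in> carrier U"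
  shows "d (g \<otimes> g') - (d g + d g') \<in> comb_span J"
proof (rule comb_span_cong)
  show "act [:mon g - 1:] (d g') \<in> comb_span J"
    using J g by (intro act_in_comb_span) (auto simp: admissible_def)
  have "act [:mon g - 1:] (d g') \<approx>\<^sub>K lmul g (d g') - d g'"
    unfolding act_const ract_diff_left using g by (intro cong_diff ract_X ract_1 V_d)
  then show "d (g \<otimes> g') - (d g + d g') \<approx>\<^sub>K act [:mon g - 1:] (d g')"
    using g by (intro cong_sym[of "act _ _"]) (simp add: lmul_d algebra_simps)
qed

lemma d_inv:
  assumes "admissible J" "g \<in> carrier U"
  shows "d (inv g) + d g \<in> comb_span J"
  using comb_span_minus[OF assms(1) d_mult[OF assms(1), of "inv g" g]] assms
  by (simp add: add.commute)

lemma d_mult_inv: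
  assumes J: "admissible J" and g: "g \<in> carrier U" "g' \<in> carrier U"
  shows "d (g \<otimes> inv g') - (d g - d g') \<in> comb_span J"
  using comb_span_add[OF J d_mult[OF J, of g "inv g'"] d_inv[OF J, of g']] g by (simp add: algebra_simps)

lemma d_commutator:
  assumes J: "admissible J" and g: "x \<in> carrier U" "y \<in> carrier U"
  shows "d (x \<otimes> y \<otimes> inv x \<otimes> inv y) \<in> comb_span J"
proof -
  have 1: "d (x \<otimes> y \<otimes> inv x \<otimes> inv y) - (d (x \<otimes> y \<otimes> inv x) - d y) \<in> comb_span J"
    using g by (intro d_mult_inv[OF J]) auto
  have 2: "d (x \<otimes> y \<otimes> inv x) - (d (x \<otimes> y) - d x) \<in> comb_span J"
    using g by (intro d_mult_inv[OF J]) auto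
  show ?thesis
    using comb_span_add[OF J 1 comb_span_add[OF J 2 d_mult[OF J g]]] by (simp add: algebra_simps)
qed

lemma d_pow:
  assumes J: "admissible J" and g: "g \<in> carrier U"
  shows "d (g [^] (k::nat)) - frag_cmul (int k) (d g) \<in> comb_span J"
proof (induction k)
  case 0
  then show ?case by (simp add: comb_span_0 J)
next
  case (Suc k)
  have "d (g [^] k \<otimes> g) - (d (g [^] k) + d g) \<in> comb_span J"
    using g by (intro d_mult J) auto
  from comb_span_add[OF J this Suc] show ?case by (simp add: frag_cmul_distrib algebra_simps)
qed

section \<open>A filtration of the group and triangular relations\<close>

text \<open>For admissible \<open>J\<close>, step \<open>i\<close> of this filtration contains the
  first \<open>i\<close> members of \<open>gens\<close>. Relative orders along it become the
  diagonal of the relation matrix.\<close>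

definition chain :: "(('a \<Rightarrow>\<^sub>0 int) \<Rightarrow>\<^sub>0 int) poly set \<Rightarrow> nat \<Rightarrow> 'a set" where
  "chain J i = {g \<in> carrier U. \<exists>c. d g - (\<Sum>j<i. frag_cmul (c j) (b j)) \<in> comb_span J}"

lemma chain_subgroup:
  assumes J: "admissible J"
  shows "subgroup (chain J i) U"
proof (rule subgroupI)
  have "\<one> \<in> chain J i"
    unfolding chain_def using J by (auto intro!: exI[of _ "\<lambda>_. 0"] comb_span_0)
  then show "chain J i \<noteq> {}" by auto
next
  fix g assume "g \<in> chain J i"
  then obtain c where g: "g \<in> carrier U" and c: "d g - (\<Sum>j<i. frag_cmul (c j) (b j)) \<in> comb_span J"
    by (auto simp: chain_def)
  have "d (inv g) - (\<Sum>j<i. frag_cmul (- c j) (b j)) \<in> comb_span J"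
    using comb_span_diff[OF J d_inv[OF J g] c] by (simp add: sum_negf algebra_simps flip: minus_frag_cmul)
  then show "inv g \<in> chain J i" unfolding chain_def using g
    by (intro CollectI conjI exI[of _ "\<lambda>j. - c j"]) auto
next
  fix g g' assume "g \<in> chain J i" "g' \<in> chain J i"
  then obtain c c' where g: "g \<in> carrier U" "g' \<in> carrier U"
    and c: "d g - (\<Sum>j<i. frag_cmul (c j) (b j)) \<in> comb_span J"
      "d g' - (\<Sum>j<i. frag_cmul (c' j) (b j)) \<in> comb_span J"
    by (auto simp: chain_def)
  have "d (g \<otimes> g') - (\<Sum>j<i. frag_cmul (c j + c' j) (b j)) \<in> comb_span J"
    using comb_span_add[OF J d_mult[OF J g] comb_span_add[OF J c]]
    by (simp add: frag_cmul_distrib sum.distrib algebra_simps)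
  then show "g \<otimes> g' \<in> chain J i" unfolding chain_def using g
    by (intro CollectI conjI exI[of _ "\<lambda>j. c j + c' j"]) auto
qed (auto simp: chain_def)

lemma chain_mono: "chain J i \<subseteq> chain J (Suc i)"
proof
  fix g assume "g \<in> chain J i"
  then obtain c where g: "g \<in> carrier U" and c: "d g - (\<Sum>j<i. frag_cmul (c j) (b j)) \<in> comb_span J"
    by (auto simp: chain_def)
  have "(\<Sum>j<Suc i. frag_cmul ((c(i := 0)) j) (b j)) = (\<Sum>j<i. frag_cmul (c j) (b j))"
    by (auto intro: sum.cong)
  with g c show "g \<in> chain J (Suc i)" unfolding chain_def
    by (intro CollectI conjI exI[of _ "c(i := 0)"]) (simp_all only:)
qed

lemma gen_in_chain:
  assumes "admissible J" "i < N"
  shows "gens ! i \<in> chain J (Suc i)"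
proof -
  have "(\<Sum>j<Suc i. frag_cmul (if j = i then 1 else 0) (b j)) = d (gens ! i)"
    by (simp add: b_def)
  then show ?thesis using assms unfolding chain_def
    by (intro CollectI conjI exI[of _ "\<lambda>j. if j = i then 1 else 0"]) (auto simp: comb_span_0)
qed

lemma derived_subset_chain:
  assumes J: "admissible J"
  shows "derived U (carrier U) \<subseteq> chain J 0"
  unfolding derived_def
  by (rule generate_subgroup_incl[OF _ chain_subgroup[OF J]]) (auto simp: chain_def d_commutator J)

text \<open>Here the description of \<open>A\<close> by generators enters: commutators have
  \<open>d\<close> in \<open>comb_span J\<close>, and \<open>d (\<gamma> x) - d x\<close> is the
  variable acting on \<open>d x\<close> modulo \<open>K\<close>, an allowed coefficient because the
  variable is in \<open>J\<close>.\<close>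

lemma A_subset_chain:
  assumes J: "admissible J" "[:0, 1:] \<in> J"
  shows "A \<subseteq> chain J 0"
proof (subst A_eq, rule generate_subgroup_incl[OF _ chain_subgroup[OF J(1)]])
  have "\<gamma> x \<otimes> inv x \<in> chain J 0" if x: "x \<in> carrier U" for x
  proof -
    have "\<Phi> (d x) \<in> comb_span J"
      using x J by (intro comb_span_cong[OF cong_sym[OF act_T]] act_in_comb_span V_d)
    then have "d (\<gamma> x) - d x \<in> comb_span J" by (simp add: \<Phi>_d)
    from comb_span_add[OF J(1) d_mult_inv[OF J(1), of "\<gamma> x" x] this] x
    show ?thesis by (simp add: chain_def)
  qed
  then show "derived U (carrier U) \<union> {\<gamma> x \<otimes> inv x | x. x \<in> carrier U} \<subseteq> chain J 0"
    using derived_subset_chain[OF J(1)] by auto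
qed

text \<open>Some power of \<open>gens ! i\<close> lies in \<open>chain J i\<close>. As
  \<open>d\<close> of a power is a multiple modulo \<open>comb_span J\<close>, this yields a
  relation with the exponent in front of \<open>b i\<close>.\<close>

lemma chain_step:
  assumes J: "admissible J" and i: "i < N"
  shows "\<exists>e c. 0 < e \<and> e * card (chain J i) \<le> card (chain J (Suc i))
    \<and> frag_cmul (int e) (b i) - (\<Sum>j<i. frag_cmul (c j) (b j)) \<in> comb_span J"
proof -
  obtain e where e: "e > 0" "gens ! i [^] (e::nat) \<in> chain J i"
      "e * card (chain J i) \<le> card (chain J (Suc i))"
    using exists_relative_order[OF fin chain_subgroup[OF J] chain_subgroup[OF J] chain_mono gen_in_chain[OF J i]]
    by blast
  then obtain c where c: "d (gens ! i [^] e) - (\<Sum>j<i. frag_cmul (c j) (b j)) \<in> comb_span J"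
    by (auto simp: chain_def)
  have "frag_cmul (int e) (b i) - (\<Sum>j<i. frag_cmul (c j) (b j)) \<in> comb_span J"
    using comb_span_diff[OF J c d_pow[OF J gens_carrier[OF i], of e]]
    by (simp add: b_def del: minus_frag_cmul)
  with e show ?thesis by blast
qed

text \<open>The inequalities of the single steps telescope; \<open>A \<subseteq> chain J 0\<close>
  and Lagrange's theorem then bound the product of the \<open>e i\<close> by the index of
  \<open>A\<close>.\<close>

lemma exists_triangular_relations:
  assumes J: "admissible J" "[:0, 1:] \<in> J"
  obtains e c where "\<And>i. i < N \<Longrightarrow> 0 < e i" "(\<Prod>i<N. e i) \<le> card (rcosets A)"
    "\<And>i. i < N \<Longrightarrow> frag_cmul (int (e i)) (b i) - (\<Sum>j<i. frag_cmul (c i j) (b j)) \<in> comb_span J"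
proof -
  define P where "P i ec \<longleftrightarrow> 0 < fst ec \<and> fst ec * card (chain J i) \<le> card (chain J (Suc i))
      \<and> frag_cmul (int (fst ec)) (b i) - (\<Sum>j<i. frag_cmul (snd ec j) (b j)) \<in> comb_span J"
    for i and ec :: "nat \<times> (nat \<Rightarrow> int)"
  have "\<exists>ec. i < N \<longrightarrow> P i ec" for i
    using chain_step[OF J(1), of i] unfolding P_def by (cases "i < N") auto
  then obtain f where f: "\<And>i. i < N \<Longrightarrow> P i (f i)" by metis
  define e c where "e i = fst (f i)" and "c i = snd (f i)" for i
  have e: "\<And>i. i < N \<Longrightarrow> 0 < e i"
      "\<And>i. i < N \<Longrightarrow> e i * card (chain J i) \<le> card (chain J (Suc i))"
      "\<And>i. i < N \<Longrightarrow> frag_cmul (int (e i)) (b i) - (\<Sum>j<i. frag_cmul (c i j) (b j)) \<in> comb_span J"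
    using f by (auto simp: P_def e_def c_def)
  have "k \<le> N \<Longrightarrow> (\<Prod>i<k. e i) * card (chain J 0) \<le> card (chain J k)" for k
  proof (induction k)
    case (Suc k)
    then have "e k * ((\<Prod>i<k. e i) * card (chain J 0)) \<le> e k * card (chain J k)" by simp
    also have "\<dots> \<le> card (chain J (Suc k))" using Suc e by simp
    finally show ?case by (simp add: mult_ac)
  qed simp
  then have "(\<Prod>i<N. e i) * card (chain J 0) \<le> card (chain J N)" by simp
  also have "\<dots> \<le> card (carrier U)" using fin by (intro card_mono) (auto simp: chain_def)
  also have "\<dots> = card (rcosets A) * card A"
    using lagrange[OF subgroup_axioms] by (simp add: Coset.order_def)
  also have "\<dots> \<le> card (rcosets A) * card (chain J 0)"
    using A_subset_chain[OF J] fin by (intro mult_le_mono2 card_mono) (auto simp: chain_def)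
  finally have "(\<Prod>i<N. e i) * card (chain J 0) \<le> card (rcosets A) * card (chain J 0)" .
  moreover have "card (chain J 0) > 0"
    using subgroup.finite_imp_card_positive[OF chain_subgroup[OF J(1)] fin] .
  ultimately have "(\<Prod>i<N. e i) \<le> card (rcosets A)" by simp
  with e that show ?thesis by blast
qed

section \<open>Determinants of relation matrices\<close>

lemma finite_rcosets: "finite (rcosets A)"
  using fin by (simp add: RCOSETS_def)

lemma keys_\<zeta>: "Poly_Mapping.keys (\<zeta> c) \<subseteq> rcosets A"
  using keys_frag_extend[of "\<lambda>m. frag_of (h m)" c] h_carrier
  by (auto simp: \<zeta>_def keys_frag_of)

lemma coset_mult_cancel:
  assumes "g \<in> carrier U" "q \<in> rcosets A" "q' \<in> rcosets A" "(A #> g) <#> q = (A #> g) <#> q'"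
  shows "q = q'"
proof -
  interpret Q: group "U Mod A" by (rule factorgroup_is_group)
  have "A #> g \<in> rcosets A" using assms(1) by (simp add: rcosetsI subset)
  then show ?thesis using assms Q.l_cancel[of "A #> g" q q'] by (simp add: FactGroup_def)
qed

lemma lookup_shift:
  assumes g: "g \<in> carrier U" and z: "Poly_Mapping.keys z \<subseteq> rcosets A" and q: "q \<in> rcosets A"
  shows "Poly_Mapping.lookup (frag_extend (\<lambda>q. frag_of ((A #> g) <#> q)) z) ((A #> g) <#> q)
    = Poly_Mapping.lookup z q"
  using z
proof (induction z rule: frag_induction)
  case (one x)
  then show ?case using coset_mult_cancel[OF g q, of x] by auto
next
  case (diff a b)
  then show ?case by (simp add: frag_extend_diff lookup_minus)
qed simp

text \<open>Only multiples of the norm are killed by the augmentation ideal of the group ring of \<open>U Mod A\<close>.\<close>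
lemma \<zeta>_invariant:
  assumes inv: "\<And>g. g \<in> carrier U \<Longrightarrow> \<zeta> (c * (mon g - 1)) = 0"
  obtains k where "\<zeta> c = (\<Sum>q\<in>rcosets A. frag_cmul k (frag_of q))" "aug c = k * int (card (rcosets A))"
proof -
  define k where "k = Poly_Mapping.lookup (\<zeta> c) A"
  have AA: "A \<in> rcosets A" by (rule subgroup_in_rcosets[OF is_group])
  \<comment> \<open>Invariance under a representative of \<open>q\<close> moves the coefficient at
    \<open>A\<close> to the coefficient at \<open>q\<close>.\<close>
  have const: "Poly_Mapping.lookup (\<zeta> c) q = k" if q: "q \<in> rcosets A" for q
  proof -
    obtain g where g: "g \<in> carrier U" "q = A #> g" using q by (auto simp: RCOSETS_def)
    have "\<zeta> c = \<zeta> (mon g * c)"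
      using inv[OF g(1)] by (simp add: right_diff_distrib \<zeta>_diff mult.commute)
    also have "\<dots> = frag_extend (\<lambda>q. frag_of ((A #> g) <#> q)) (\<zeta> c)"
      using g by (simp add: \<zeta>_mult_single h_frag)
    finally have "Poly_Mapping.lookup (\<zeta> c) ((A #> g) <#> A) = k"
      using lookup_shift[OF g(1) keys_\<zeta> AA, of c] by (simp add: k_def)
    moreover have "(A #> g) <#> A = q"
      using rcos_sum[OF g(1) one_closed] g subset by simp
    ultimately show ?thesis by simp
  qed
  have 1: "\<zeta> c = (\<Sum>q\<in>rcosets A. frag_cmul k (frag_of q))"
  proof (rule poly_mapping_eqI)
    fix q
    have "Poly_Mapping.lookup (\<Sum>q\<in>rcosets A. frag_cmul k (frag_of q)) q
        = (\<Sum>q'\<in>rcosets A. if q' = q then k else 0)"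
      by (auto simp: lookup_sum intro!: sum.cong)
    also have "\<dots> = Poly_Mapping.lookup (\<zeta> c) q"
      using const[of q] keys_\<zeta>[of c] finite_rcosets
      by (auto simp: sum.delta in_keys_iff)
    finally show "Poly_Mapping.lookup (\<zeta> c) q
        = Poly_Mapping.lookup (\<Sum>q\<in>rcosets A. frag_cmul k (frag_of q)) q" ..
  qed
  have "aug c = aug (\<zeta> c)"
    by (induction c rule: frag_induction[OF subset_UNIV]) (simp_all add: aug_diff \<zeta>_diff)
  also have "\<dots> = k * int (card (rcosets A))"
    unfolding 1 by (simp add: aug_sum finite_rcosets aug_cmul)
  finally show ?thesis using that 1 by blast
qed

definition norm_el :: "('a \<Rightarrow>\<^sub>0 int) \<Rightarrow> 'a \<Rightarrow>\<^sub>0 int" where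
  "norm_el f = (\<Sum>q\<in>rcosets A. lmul (sec q) f)"

lemma ract_norm:
  assumes "\<zeta> c = (\<Sum>q\<in>rcosets A. frag_cmul 1 (frag_of q))"
  shows "ract c f = norm_el f"
  unfolding ract_\<zeta> assms norm_el_def by (simp add: frag_extend_sum finite_rcosets)

text \<open>Applying \<open>\<epsilon>\<close> to each row gives a relation between the elements
  \<open>mon g - 1\<close> over the group ring of \<open>U Mod A\<close>, with the constant
  coefficients as entries. The adjugate then shows that the determinant kills each of them.\<close>

lemma \<zeta>_det:
  assumes P: "P \<in> carrier_mat N N"
    and rows: "\<And>i. i < N \<Longrightarrow> (\<Sum>j<N. act (P $$ (i, j)) (b j)) \<in> K"
    and g: "g \<in> carrier U"
  shows "\<zeta> (Polynomial.coeff (det P) 0 * (mon g - 1)) = 0"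
proof -
  obtain i where i: "i < N" "gens ! i = g" using obtain_index[OF g] by metis
  define Z where "Z p = \<zeta> (Polynomial.coeff p 0)" for p
  define \<beta> where "\<beta> l = [:mon (gens ! l) - 1:]" for l
  have "Z (det P * \<beta> i) = 0"
  proof (rule det_annihilates_modulo[OF P i(1)])
    show "Z (x + y) = Z x + Z y" for x y by (simp add: Z_def \<zeta>_add)
    show "Z x = 0 \<Longrightarrow> Z (y * x) = 0" for x y by (simp add: Z_def coeff_mult_0 \<zeta>_ideal)
    fix l assume l: "l < N"
    have "Z (\<Sum>j<N. P $$ (l, j) * \<beta> j) = (\<Sum>j<N. \<epsilon> (act (P $$ (l, j)) (b j)))"
      by (simp add: Z_def \<beta>_def coeff_sum \<zeta>_sum coeff_mult_0 \<epsilon>_act_d b_def mult.commute)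
    also have "\<dots> = \<epsilon> (\<Sum>j<N. act (P $$ (l, j)) (b j))" by (simp add: \<epsilon>_sum)
    also have "\<dots> = 0" by (rule \<epsilon>_K[OF rows[OF l]])
    finally show "Z (\<Sum>j<N. P $$ (l, j) * \<beta> j) = 0" .
  qed
  then show ?thesis using i by (simp add: Z_def \<beta>_def coeff_mult_0 mult.commute)
qed

lemma act_cmul_one: "f \<in> V \<Longrightarrow> act [:frag_cmul k 1:] f \<approx>\<^sub>K frag_cmul k f"
proof -
  assume "f \<in> V"
  then have 1: "ract 1 f - f \<in> K" using ract_1 by (simp add: cong_K_def)
  have "frag_cmul k (ract 1 f - f) \<in> K"
    by (rule frag_closure_minus_cmul[where P = "\<lambda>f. f \<in> K", OF K_zero K_diff 1])
  moreover have "frag_cmul k (ract 1 f - f) = frag_cmul k (ract 1 f) - frag_cmul k f"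
    by (rule poly_mapping_eqI) (simp add: lookup_minus right_diff_distrib)
  ultimately show ?thesis
    by (simp add: cong_K_def act_const ract_def frag_extend_cmul)
qed

lemma admissible_paug: "admissible {p. paug p = 0}"
  by (auto simp: admissible_def paug_def aug_diff)

lemma admissible_const: "admissible {[:c:] | c. aug c = 0}"
  by (auto simp: admissible_def aug_diff)

text \<open>\<open>W\<close> is a triangular integral relation matrix of \<open>U Mod A\<close> minus a matrix over the ideal
  generated by the variable and the augmentation ideal. The bound on the determinant suffices
  to identify it later, since it is also a multiple of the order of \<open>U Mod A\<close>.\<close>
lemma relation_matrix:
  obtains W where "W \<in> carrier_mat N N"
    "\<forall>i<N. (\<Sum>j<N. act (W $$ (i, j)) (b j)) \<in> K"
    "0 < paug (det W)" "paug (det W) \<le> int (card (rcosets A))"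
proof -
  let ?J = "{p. paug p = 0} :: (('a \<Rightarrow>\<^sub>0 int) \<Rightarrow>\<^sub>0 int) poly set"
  have T: "[:0, 1:] \<in> ?J" by (simp add: paug_def)
  obtain e c where e: "\<And>i. i < N \<Longrightarrow> 0 < e i" "(\<Prod>i<N. e i) \<le> card (rcosets A)"
    and rel: "\<And>i. i < N \<Longrightarrow> frag_cmul (int (e i)) (b i) - (\<Sum>j<i. frag_cmul (c i j) (b j)) \<in> comb_span ?J"
    using exists_triangular_relations[OF admissible_paug T] by blast
  from rel have "\<forall>i\<in>{..<N}. \<exists>v. (\<forall>j. paug (v j) = 0) \<and>
      frag_cmul (int (e i)) (b i) - (\<Sum>j<i. frag_cmul (c i j) (b j)) \<approx>\<^sub>K comb v"
    unfolding comb_span_def by (fastforce simp: image_subset_iff)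
  from bchoice[OF this] obtain v where v: "\<And>i j. i < N \<Longrightarrow> paug (v i j) = 0"
    "\<And>i. i < N \<Longrightarrow> frag_cmul (int (e i)) (b i) - (\<Sum>j<i. frag_cmul (c i j) (b j)) \<approx>\<^sub>K comb (v i)"
    by auto
  \<comment> \<open>The lower triangular integral part, with the relative orders on the
    diagonal.\<close>
  define E where "E i j = (if j = i then int (e i) else if j < i then - c i j else 0)" for i j
  define W where "W = mat N N (\<lambda>(i, j). [:frag_cmul (E i j) 1:] - v i j)"
  have W: "W \<in> carrier_mat N N" by (simp add: W_def)
  have rows: "(\<Sum>j<N. act (W $$ (i, j)) (b j)) \<in> K" if i: "i < N" for i
  proof -
    have "(\<Sum>j<N. act (W $$ (i, j)) (b j)) = (\<Sum>j<N. act [:frag_cmul (E i j) 1:] (b j)) - comb (v i)"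
      using i by (simp add: W_def comb_def act_diff_left sum_subtractf)
    also have "\<dots> \<approx>\<^sub>K (\<Sum>j<N. frag_cmul (E i j) (b j)) - comb (v i)"
      by (intro cong_diff cong_sum act_cmul_one cong_refl) auto
    also have "(\<Sum>j<N. frag_cmul (E i j) (b j)) = (\<Sum>j<Suc i. frag_cmul (E i j) (b j))"
      using i by (intro sum.mono_neutral_right) (auto simp: E_def)
    also have "\<dots> = frag_cmul (int (e i)) (b i) - (\<Sum>j<i. frag_cmul (c i j) (b j))"
      by (simp add: E_def sum_negf flip: minus_frag_cmul)
    finally show ?thesis using v(2)[OF i] cong_K_iff by (simp add: cong_K_def)
  qed
  \<comment> \<open>\<open>paug\<close> kills the corrections \<open>v i j\<close>, leaving the
    determinant of \<open>E\<close>.\<close>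
  have "paug (det W) = det (map_mat paug W)" by simp
  also have "\<dots> = (\<Prod>i<N. int (e i))"
  proof (subst det_lower_triangular[of N])
    show "map_mat paug W $$ (i, j) = 0" if "i < j" "j < N" for i j
      using that v(1)[unfolded paug_def] by (simp add: W_def E_def paug_def aug_diff aug_minus)
    show "prod_list (diag_mat (map_mat paug W)) = (\<Prod>i<N. int (e i))"
      using v(1)[unfolded paug_def]
      by (auto simp: prod_list_diag_prod W_def E_def paug_def aug_diff aug_cmul lessThan_atLeast0
          intro!: prod.cong)
  qed (use W in simp)
  finally have det: "paug (det W) = int (\<Prod>i<N. e i)" by simp
  show ?thesis
  proof (rule that[OF W])
    show "\<forall>i<N. (\<Sum>j<N. act (W $$ (i, j)) (b j)) \<in> K" using rows by blast
    show "0 < paug (det W)" using e(1) unfolding det of_nat_prod by (intro prod_pos) auto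
    show "paug (det W) \<le> int (card (rcosets A))" using e(2) unfolding det by (simp only: of_nat_le_iff)
  qed
qed

text \<open>That the class of \<open>u\<close> is fixed gives
  \<open>\<gamma> u = a \<otimes> u\<close> with \<open>a\<close> in the derived subgroup, and then
  \<open>\<Phi> (d u)\<close> agrees with \<open>d a\<close> modulo \<open>K\<close>. Since
  \<open>a\<close> is a product of commutators, and not just in \<open>A\<close>, the coefficients
  of \<open>d a\<close> are constants of augmentation zero; so the variable occurs only in entry
  \<open>x\<close>.\<close>

lemma special_row:
  assumes u: "u \<in> carrier U"
    and fixed: "derived U (carrier U) #> \<gamma> u = derived U (carrier U) #> u"
    and x: "x < N" "gens ! x = u"
  obtains r where "(\<Sum>j<N. act (r j) (b j)) \<in> K" "\<forall>j. paug (r j) = 0"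
    "\<forall>j. poly_shift 1 (r j) = (if j = x then 1 else 0)"
proof -
  let ?J = "{[:c:] | c. aug c = 0} :: (('a \<Rightarrow>\<^sub>0 int) \<Rightarrow>\<^sub>0 int) poly set"
  have "\<gamma> u \<in> derived U (carrier U) #> u"
    using fixed rcos_self[OF \<gamma>_closed[OF u] derived_is_subgroup[OF subset_refl]] by simp
  then obtain a where a: "a \<in> derived U (carrier U)" "\<gamma> u = a \<otimes> u" by (auto simp: r_coset_def)
  have aA: "a \<in> A" using a derived_sub by blast
  have "\<Phi> (d u) = lmul a (d u) - d u + d a"
    using a aA u by (simp add: \<Phi>_d lmul_d mem_carrier)
  moreover have "lmul a (d u) - d u + d a \<approx>\<^sub>K 0 + d a"
    using u aA by (intro cong_add) (auto simp: cong_K_def intro: K_gen)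
  ultimately have 1: "\<Phi> (d u) \<approx>\<^sub>K d a" by simp
  have "d a \<in> comb_span ?J"
    using derived_subset_chain[OF admissible_const] a by (auto simp: chain_def)
  then obtain v where v: "range v \<subseteq> ?J" "d a \<approx>\<^sub>K comb v" by (auto simp: comb_span_def)
  define r where "r j = (if j = x then [:0, 1:] else 0) - v j" for j
  have "(\<Sum>j<N. act (r j) (b j)) = (\<Sum>j<N. if j = x then act [:0, 1:] (b x) else 0) - comb v"
    unfolding comb_def sum_subtractf[symmetric]
    by (rule sum.cong) (auto simp: r_def act_diff_left)
  also have "\<dots> = act [:0, 1:] (d u) - comb v"
    using x by (simp add: sum.delta b_def)
  also have "\<dots> \<approx>\<^sub>K \<Phi> (d u) - \<Phi> (d u)"
    using u by (intro cong_diff act_T V_d cong_sym[OF cong_trans[OF 1 v(2)]])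
  finally have 2: "(\<Sum>j<N. act (r j) (b j)) \<in> K" by (simp add: cong_K_def)
  have "\<forall>j. \<exists>c. v j = [:c:] \<and> aug c = 0" using v(1) by (auto simp: image_subset_iff)
  then obtain w where w: "\<And>j. v j = [:w j:]" "\<And>j. aug (w j) = 0" by metis
  have "paug (r j) = 0" for j
    by (simp add: r_def paug_def w aug_diff aug_minus)
  moreover have "poly_shift 1 (r j) = (if j = x then 1 else 0)" for j
    by (auto simp: r_def w poly_eq_iff coeff_poly_shift coeff_pCons split: nat.split)
  ultimately show ?thesis using that 2 by blast
qed

lemma norm_in_K:
  assumes u: "u \<in> carrier U"
    and fixed: "derived U (carrier U) #> \<gamma> u = derived U (carrier U) #> u"
  shows "norm_el (d u) \<in> K"
proof -
  obtain x where x: "x < N" "gens ! x = u" "b x = d u" using obtain_index[OF u] by metis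
  obtain W where W: "W \<in> carrier_mat N N"
    and rows': "\<forall>i<N. (\<Sum>j<N. act (W $$ (i, j)) (b j)) \<in> K"
    and det: "0 < paug (det W)" "paug (det W) \<le> int (card (rcosets A))"
    by (rule relation_matrix)
  then have rows: "(\<Sum>j<N. act (W $$ (i, j)) (b j)) \<in> K" if "i < N" for i
    using that by blast
  obtain r where r: "(\<Sum>j<N. act (r j) (b j)) \<in> K" "\<forall>j. paug (r j) = 0"
    "\<forall>j. poly_shift 1 (r j) = (if j = x then 1 else 0)"
    by (rule special_row[OF u fixed x(1,2)])
  define P where "P k = mat N N (\<lambda>(i, l). if i = k then r l else W $$ (i, l))" for k
  define D where "D = det W"
  have ract_D: "ract (Polynomial.coeff D 0) f = norm_el f" for f
  proof -
    obtain k where k: "\<zeta> (Polynomial.coeff D 0) = (\<Sum>q\<in>rcosets A. frag_cmul k (frag_of q))"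
      "paug D = k * int (card (rcosets A))"
      unfolding D_def paug_def by (rule \<zeta>_invariant[OF \<zeta>_det[OF W rows]])
    \<comment> \<open>\<open>paug D\<close> is positive, at most the index of \<open>A\<close>, and
      equal to \<open>k\<close> times this index.\<close>
    have "k = 1"
    proof -
      have "0 < k * int (card (rcosets A))" using det k(2) by (simp add: D_def)
      then have n: "0 < int (card (rcosets A))" "0 < k" by (auto simp: zero_less_mult_iff)
      have "k * int (card (rcosets A)) \<le> 1 * int (card (rcosets A))" using det k(2) by (simp add: D_def)
      then have "k \<le> 1" using n(1) by (simp only: mult_le_cancel_right_pos)
      then show ?thesis using n by simp
    qed
    then show ?thesis using k(1) ract_norm by blast
  qed
  \<comment> \<open>Row \<open>k\<close> of \<open>P k\<close> is \<open>r\<close>, whose entries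
    have \<open>paug\<close> zero. So the determinant has augmentation zero, and the multiple of the
    norm that it defines vanishes.\<close>
  have \<zeta>_P: "\<zeta> (Polynomial.coeff (det (P k)) 0) = 0" if k: "k < N" for k
  proof -
    have PN: "P k \<in> carrier_mat N N" by (simp add: P_def)
    have "(\<Sum>j<N. act (P k $$ (i, j)) (b j)) \<in> K" if "i < N" for i
      using that r(1) rows by (cases "i = k") (simp_all add: P_def)
    then obtain c where c: "\<zeta> (Polynomial.coeff (det (P k)) 0) = (\<Sum>q\<in>rcosets A. frag_cmul c (frag_of q))"
      "paug (det (P k)) = c * int (card (rcosets A))"
      unfolding paug_def by (rule \<zeta>_invariant[OF \<zeta>_det[OF PN]])
    have "paug (det (P k)) = (\<Sum>j<N. paug (P k $$ (k, j)) * paug (cofactor (P k) k j))"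
      by (subst laplace_expansion_row[OF PN k]) (simp add: paug.hom_sum paug.hom_mult)
    also have "\<dots> = 0" using k by (intro sum.neutral) (simp add: P_def r(2))
    finally have "c = 0" using c(2) det by auto
    then show ?thesis using c(1) by simp
  qed
  \<comment> \<open>Cramer's identity in column \<open>j\<close>, with the constant term dropped and
    the rest divided by the variable on both sides.\<close>
  have *: "act (Polynomial.smult (Polynomial.coeff D 0) (poly_shift 1 (r j)) + poly_shift 1 D * r j) (b j)
      = (\<Sum>k<N. act (Polynomial.smult (Polynomial.coeff (det (P k)) 0) (poly_shift 1 (W $$ (k, j)))
          + poly_shift 1 (det (P k)) * W $$ (k, j)) (b j))" if j: "j < N" for j
    using arg_cong[OF cramer_row_combination[OF W j, of r], of "\<lambda>p. act (poly_shift 1 p) (b j)"]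
    unfolding P_def[symmetric] D_def[symmetric]
    by (simp only: tail_sum[OF finite_lessThan] tail_mult act_sum_left[OF finite_lessThan])
  \<comment> \<open>The added term is in \<open>K\<close> because \<open>r\<close> is a relation. It
    completes the sum to the left side of the identity above, summed over \<open>j\<close>.\<close>
  have "norm_el (d u) \<approx>\<^sub>K (\<Sum>j<N. if j = x then norm_el (b x) else 0) + act (poly_shift 1 D) (\<Sum>j<N. act (r j) (b j))"
    using act_K[OF r(1)] x K_minus by (simp add: sum.delta cong_K_def)
  also have "\<dots> = (\<Sum>j<N. (if j = x then norm_el (b x) else 0) + act (poly_shift 1 D) (act (r j) (b j)))"
    by (simp only: act_sum[OF finite_lessThan] sum.distrib)
  also have "\<dots> \<approx>\<^sub>K (\<Sum>j<N. act (Polynomial.smult (Polynomial.coeff D 0) (poly_shift 1 (r j)) + poly_shift 1 D * r j) (b j))"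
  proof (rule cong_sum)
    fix j assume "j \<in> {..<N}"
    then have j: "b j \<in> V" by auto
    show "(if j = x then norm_el (b x) else 0) + act (poly_shift 1 D) (act (r j) (b j))
        \<approx>\<^sub>K act (Polynomial.smult (Polynomial.coeff D 0) (poly_shift 1 (r j)) + poly_shift 1 D * r j) (b j)"
      unfolding act_add_left
    proof (rule cong_add)
      have "(if j = x then norm_el (b x) else 0) = act [:if j = x then Polynomial.coeff D 0 else 0:] (b j)"
        by (simp add: act_const ract_D)
      also have "[:if j = x then Polynomial.coeff D 0 else 0:] = Polynomial.smult (Polynomial.coeff D 0) (poly_shift 1 (r j))"
        by (simp only: r(3)[rule_format]) simp
      finally show "(if j = x then norm_el (b x) else 0) \<approx>\<^sub>K act (Polynomial.smult (Polynomial.coeff D 0) (poly_shift 1 (r j))) (b j)"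
        by simp
    qed (rule cong_sym[OF act_mult[OF j]])
  qed simp
  also have "\<dots> = (\<Sum>j<N. \<Sum>k<N. act (Polynomial.smult (Polynomial.coeff (det (P k)) 0) (poly_shift 1 (W $$ (k, j)))
          + poly_shift 1 (det (P k)) * W $$ (k, j)) (b j))"
    by (intro sum.cong refl *) simp
  also have "\<dots> \<approx>\<^sub>K (\<Sum>j<N. \<Sum>k<N. act (poly_shift 1 (det (P k))) (act (W $$ (k, j)) (b j)))"
  proof (intro cong_sum)
    fix j k assume "j \<in> {..<N}" "k \<in> {..<N}"
    then have j: "b j \<in> V" and k: "k < N" by auto
    \<comment> \<open>The constant coefficient of \<open>det (P k)\<close> is killed by
      \<open>\<zeta>\<close> and so acts as zero; only a multiple of an entry of row
      \<open>k\<close> of \<open>W\<close> remains.\<close>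
    have "act (Polynomial.smult (Polynomial.coeff (det (P k)) 0) (poly_shift 1 (W $$ (k, j)))) (b j) \<approx>\<^sub>K 0"
      using act_smult[OF j, of "Polynomial.coeff (det (P k)) 0" "poly_shift 1 (W $$ (k, j))"] \<zeta>_P[OF k]
      by (simp add: ract_\<zeta>)
    from cong_add[OF this act_mult[OF j, of "poly_shift 1 (det (P k))" "W $$ (k, j)"]]
    show "act (Polynomial.smult (Polynomial.coeff (det (P k)) 0) (poly_shift 1 (W $$ (k, j)))
          + poly_shift 1 (det (P k)) * W $$ (k, j)) (b j) \<approx>\<^sub>K act (poly_shift 1 (det (P k))) (act (W $$ (k, j)) (b j))"
      by (simp add: act_add_left)
  qed simp_all
  also have "\<dots> = (\<Sum>k<N. act (poly_shift 1 (det (P k))) (\<Sum>j<N. act (W $$ (k, j)) (b j)))"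
    by (subst sum.swap) (simp add: act_sum)
  finally have "norm_el (d u)
      \<approx>\<^sub>K (\<Sum>k<N. act (poly_shift 1 (det (P k))) (\<Sum>j<N. act (W $$ (k, j)) (b j)))" .
  then show ?thesis
    \<comment> \<open>Each inner sum is now a full row relation of \<open>W\<close>.\<close>
    by (rule cong_K_iff[THEN iffD2]) (intro K_sum act_K rows, simp_all)
qed

section \<open>Retraction onto the abelian subgroup\<close>

abbreviation A_grp :: "('a, 'b) monoid_scheme" where
  "A_grp \<equiv> U\<lparr>carrier := A\<rparr>"

text \<open>Linearly extended, \<open>ret\<close> kills \<open>K\<close> and sends the norm of \<open>d x\<close> to the transfer of \<open>x\<close>.\<close>
definition ret :: "'a \<Rightarrow> 'a" where
  "ret g = g \<otimes> inv (sec (A #> g))"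

lemma sec_carrier [simp, intro]: "g \<in> carrier U \<Longrightarrow> sec (A #> g) \<in> carrier U"
  and coset_sec [simp]: "g \<in> carrier U \<Longrightarrow> A #> sec (A #> g) = A #> g"
  using sec rcosetsI[OF subset] by auto

lemma ret_A: "g \<in> carrier U \<Longrightarrow> ret g \<in> A"
  unfolding ret_def
  by (rule rcos_module_imp[OF is_group sec_carrier])
    (simp_all add: rcos_self subgroup_axioms)

lemma ret_mult:
  assumes "a \<in> A" "g \<in> carrier U"
  shows "ret (a \<otimes> g) = a \<otimes> ret g"
proof -
  have "A #> (a \<otimes> g) = A #> g"
    using assms by (simp add: coset_join2 subgroup_axioms subset flip: coset_mult_assoc)
  then show ?thesis using assms by (simp add: ret_def m_assoc)
qed

text \<open>As \<open>A\<close> is abelian, \<open>ret\<close> extends to a homomorphism by the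
  universal property of the free abelian group on \<open>carrier U\<close>; the conditions on keys
  select the elements of that group.\<close>

lemma exists_retraction:
  obtains p where "\<And>f f'. Poly_Mapping.keys f \<subseteq> carrier U \<Longrightarrow> Poly_Mapping.keys f' \<subseteq> carrier U
      \<Longrightarrow> p (f + f') = p f \<otimes> p f'"
    "\<And>f. Poly_Mapping.keys f \<subseteq> carrier U \<Longrightarrow> p f \<in> A"
    "\<And>g. g \<in> carrier U \<Longrightarrow> p (frag_of g) = ret g"
proof -
  interpret AG: comm_group A_grp by (rule A_comm)
  obtain p where "p \<in> hom (free_Abelian_group (carrier U)) A_grp"
    and "\<And>g. g \<in> carrier U \<Longrightarrow> p (frag_of g) = ret g"
    using AG.free_Abelian_group_universal[of ret "carrier U"] ret_A by auto
  then show ?thesis by (intro that[of p]) (auto simp: hom_def)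
qed

lemma keys_d: "g \<in> carrier U \<Longrightarrow> Poly_Mapping.keys (d g) \<subseteq> carrier U"
  using keys_diff[of "frag_of g" "frag_of \<one>"] by (auto simp: d_def keys_frag_of)

lemma keys_V: "f \<in> V \<Longrightarrow> Poly_Mapping.keys f \<subseteq> carrier U"
proof (induction f rule: V.induct)
  case (V_diff f f')
  then show ?case using keys_diff[of f f'] by blast
qed (simp_all add: keys_d)

text \<open>The extended retraction sends \<open>norm_el (d x)\<close> to the product of
  \<open>ret (s \<otimes> x)\<close> over the representatives \<open>s\<close>, which is the
  transfer computed with \<open>T\<close>, and it sends \<open>K\<close> to
  \<open>\<one>\<close>.\<close>

lemma transfer_trivial:
  assumes x: "x \<in> carrier U" and norm: "norm_el (d x) \<in> K"
  shows "finprod A_grp (\<lambda>t. t \<otimes> x \<otimes> inv (transversal_rep U A T (t \<otimes> x))) T = \<one>"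
proof -
  interpret AG: comm_group A_grp by (rule A_comm)
  obtain p where add: "\<And>f f'. Poly_Mapping.keys f \<subseteq> carrier U \<Longrightarrow> Poly_Mapping.keys f' \<subseteq> carrier U
      \<Longrightarrow> p (f + f') = p f \<otimes> p f'"
    and closed: "\<And>f. Poly_Mapping.keys f \<subseteq> carrier U \<Longrightarrow> p f \<in> A"
    and p_of: "\<And>g. g \<in> carrier U \<Longrightarrow> p (frag_of g) = ret g"
    by (rule exists_retraction) blast
  have cl: "p f \<in> carrier U" if "Poly_Mapping.keys f \<subseteq> carrier U" for f
    using closed[OF that] by (rule mem_carrier)
  have zero: "p 0 = \<one>"
    using add[of 0 0] cl[of 0] by (simp add: r_cancel_one')
  have diff: "p (f - f') = p f \<otimes> inv p f'"
    if "Poly_Mapping.keys f \<subseteq> carrier U" "Poly_Mapping.keys f' \<subseteq> carrier U" for f f'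
  proof -
    have k: "Poly_Mapping.keys (f - f') \<subseteq> carrier U" using keys_diff[of f f'] that by blast
    have "p f = p (f - f') \<otimes> p f'" using add[OF k that(2)] by simp
    then show ?thesis using cl[OF k] cl[OF that(2)] by (simp add: m_assoc)
  qed
  have p_K: "p f = \<one>" if "f \<in> K" for f
    using that
  proof (induction f rule: K.induct)
    case (K_gen a g)
    have a: "a \<in> carrier U" using K_gen mem_carrier by blast
    have k: "Poly_Mapping.keys (frag_of y - frag_of z :: 'a \<Rightarrow>\<^sub>0 int) \<subseteq> carrier U"
      if "y \<in> carrier U" "z \<in> carrier U" for y z
      using keys_diff[of "frag_of y :: 'a \<Rightarrow>\<^sub>0 int" "frag_of z"] that by (auto simp: keys_frag_of)
    \<comment> \<open>\<open>ret \<one>\<close> need not be \<open>\<one>\<close>, since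
      \<open>T\<close> may represent \<open>A\<close> by another element. The two factors from
      \<open>a\<close> cancel because \<open>A\<close> is abelian.\<close>
    have "p (frag_of (a \<otimes> g) - frag_of a) = (a \<otimes> ret g) \<otimes> inv (a \<otimes> ret \<one>)"
      using K_gen a ret_mult[of a g] ret_mult[of a \<one>] by (simp add: diff keys_frag_of p_of)
    also have "\<dots> = a \<otimes> (ret g \<otimes> inv ret \<one>) \<otimes> inv a"
      using K_gen a ret_A mem_carrier by (simp add: inv_mult_group m_assoc)
    also have "\<dots> = ret g \<otimes> inv ret \<one>"
    proof -
      have "ret g \<otimes> inv ret \<one> \<in> A" using K_gen ret_A by simp
      then have "a \<otimes> (ret g \<otimes> inv ret \<one>) = (ret g \<otimes> inv ret \<one>) \<otimes> a"
        using AG.m_comm[of a "ret g \<otimes> inv ret \<one>"] K_gen by simp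
      then show ?thesis using K_gen a ret_A mem_carrier by (simp add: m_assoc)
    qed
    also have "\<dots> = p (d g)"
      using K_gen by (simp add: d_def diff keys_frag_of p_of)
    finally have eq: "p (lmul a (d g)) = p (d g)"
      using a by (simp add: d_def lmul_diff)
    have kl: "Poly_Mapping.keys (lmul a (d g)) \<subseteq> carrier U"
      using k[of "a \<otimes> g" a] a K_gen by (simp add: d_def lmul_diff)
    show ?case using diff[OF kl keys_d] cl[OF keys_d] K_gen by (simp add: eq)
  next
    case (K_diff f f')
    then show ?case using keys_V[OF K_V] by (simp add: diff)
  qed (rule zero)
  have bij: "bij_betw sec (rcosets A) T"
  proof (rule bij_betwI[where g = "\<lambda>t. A #> t"])
    show "sec \<in> rcosets A \<rightarrow> T" using sec(1) by blast
    have TU: "T \<subseteq> carrier U" using T by (simp add: right_transversal_def)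
    show "(#>) A \<in> T \<rightarrow> rcosets A" using TU rcosetsI[OF subset] by blast
  qed (simp_all add: sec(3) sec_coset)
  have p_term: "p (lmul (sec q) (d x)) = sec q \<otimes> x \<otimes> inv (transversal_rep U A T (sec q \<otimes> x))"
    if q: "q \<in> rcosets A" for q
  proof -
    \<comment> \<open>An element of \<open>T\<close> is the representative of its own coset.\<close>
    have "ret (sec q) = \<one>" using sec[OF q] by (simp add: ret_def)
    then have "p (lmul (sec q) (d x)) = ret (sec q \<otimes> x)"
      using sec[OF q] x ret_A[of "sec q \<otimes> x"] mem_carrier
      by (simp add: d_def lmul_diff diff keys_frag_of p_of)
    \<comment> \<open>\<open>sec\<close> and \<open>transversal_rep\<close> unfold to the same
      definite description.\<close>
    then show ?thesis by (simp add: ret_def sec_def transversal_rep_def)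
  qed
  have keys: "Poly_Mapping.keys (lmul (sec q) (d x)) \<subseteq> carrier U" if "q \<in> rcosets A" for q
    using that x by (intro keys_V lmul_V V_d sec)
  have p_sum: "p (\<Sum>q\<in>I. lmul (sec q) (d x)) = finprod A_grp (\<lambda>q. p (lmul (sec q) (d x))) I"
    if "finite I" "I \<subseteq> rcosets A" for I
    using that
  proof (induction I rule: finite_induct)
    case (insert q I)
    have "Poly_Mapping.keys (\<Sum>q\<in>I. lmul (sec q) (d x)) \<subseteq> carrier U"
      using insert x by (intro keys_V V_sum lmul_V V_d sec(2)) auto
    moreover have "(\<lambda>q. p (lmul (sec q) (d x))) \<in> I \<rightarrow> carrier A_grp"
      using insert closed keys by auto
    ultimately show ?case using insert keys closed by (simp add: add)
  qed (simp add: zero)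
  have "finprod A_grp (\<lambda>t. t \<otimes> x \<otimes> inv (transversal_rep U A T (t \<otimes> x))) T
      = finprod A_grp (\<lambda>t. t \<otimes> x \<otimes> inv (transversal_rep U A T (t \<otimes> x))) (sec ` (rcosets A))"
    using bij by (simp add: bij_betw_def)
  also have "\<dots> = finprod A_grp (\<lambda>q. sec q \<otimes> x \<otimes> inv (transversal_rep U A T (sec q \<otimes> x))) (rcosets A)"
  proof (rule AG.finprod_reindex)
    show "(\<lambda>t. t \<otimes> x \<otimes> inv (transversal_rep U A T (t \<otimes> x))) \<in> sec ` (rcosets A) \<rightarrow> carrier A_grp"
      using closed keys by (auto simp flip: p_term)
    show "inj_on sec (rcosets A)" using bij by (simp add: bij_betw_def)
  qed
  also have "\<dots> = finprod A_grp (\<lambda>q. p (lmul (sec q) (d x))) (rcosets A)"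
    by (rule AG.finprod_cong) (use closed keys in \<open>auto simp: p_term simp_implies_def simp flip: p_term\<close>)
  also have "\<dots> = p (norm_el (d x))"
    using p_sum[OF finite_rcosets] by (simp add: norm_el_def)
  also have "\<dots> = \<one>" by (rule p_K[OF norm])
  finally show ?thesis .
qed

end

theorem theorem10:
  fixes U :: "('a, 'b) monoid_scheme" and A :: "'a set" and \<gamma> :: "'a \<Rightarrow> 'a" and u :: 'a
  assumes "group U"
    and "finite (carrier U)"
    and "A \<lhd> U"
    and "comm_group (U\<lparr>carrier := A\<rparr>)"
    and "derived U (carrier U) \<subseteq> A"
    and "\<gamma> \<in> hom U U"
    and "A = generate U (derived U (carrier U) \<union>
                         {\<gamma> x \<otimes>\<^bsub>U\<^esub> inv\<^bsub>U\<^esub> x | x. x \<in> carrier U})"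
    and "u \<in> carrier U"
    and "derived U (carrier U) #>\<^bsub>U\<^esub> \<gamma> u = derived U (carrier U) #>\<^bsub>U\<^esub> u"
  shows "transfer U A u = \<one>\<^bsub>U\<^esub>"
proof -
  interpret normal A U by (rule assms(3))
  \<comment> \<open>This is the transversal that \<open>transfer\<close> itself selects, so the
    product in \<open>transfer_trivial\<close> is literally the one in its definition.\<close>
  define T where "T = (SOME T. right_transversal U A T)"
  have T: "right_transversal U A T"
    unfolding T_def by (rule someI_ex[OF exists_right_transversal[OF subgroup_axioms]])
  interpret Q: group "U Mod A" by (rule factorgroup_is_group)
  have comm: "x \<otimes>\<^bsub>U Mod A\<^esub> y = y \<otimes>\<^bsub>U Mod A\<^esub> x"
    if xy: "x \<in> carrier (U Mod A)" "y \<in> carrier (U Mod A)" for x y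
    using xy rcos_commute[OF assms(5)] by (auto simp: carrier_FactGroup rcos_sum)
  interpret Q: comm_group "U Mod A" by (rule Q.group_comm_groupI) (rule comm)
  \<comment> \<open>The group ring is built over the whole type \<open>'a\<close>, so elements
    outside \<open>U\<close> need a value; they go to the identity coset.\<close>
  have "(\<lambda>x. if x \<in> carrier U then A #>\<^bsub>U\<^esub> x else A) ` UNIV \<subseteq> carrier (U Mod A)"
    using Q.one_closed by (auto simp: carrier_FactGroup)
  from Q.free_Abelian_group_universal[OF this]
  obtain h where h: "h \<in> hom (free_Abelian_group UNIV) (U Mod A)"
    and h_of: "\<And>x. h (frag_of x) = (if x \<in> carrier U then A #>\<^bsub>U\<^esub> x else A)"
    by (metis UNIV_I)
  interpret transfer_setting A U \<gamma> T h
  proof (intro transfer_setting.intro transfer_setting_axioms.intro)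
    show "h m \<in> rcosets\<^bsub>U\<^esub> A" for m using h by (auto simp: hom_def FactGroup_def)
    show "h (m + m') = h m <#>\<^bsub>U\<^esub> h m'" for m m' using h by (auto simp: hom_def)
    show "h (frag_of g) = A #>\<^bsub>U\<^esub> g" if "g \<in> carrier U" for g using that by (simp add: h_of)
  qed (fact assms T)+
  show ?thesis
    using transfer_trivial[OF assms(8) norm_in_K[OF assms(8,9)]]
    by (simp add: transfer_def Let_def T_def[symmetric])
qed

end
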